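(* The functor $\mathbb{O}/\mathbb{R}$ is isomorphic to the diagonal part of the prop $\mathrm{End}_{\mathbb{Z}_2[\mathbb{A}^1]}$ as Boole-Weyl algebra valued functors. That is, writing $V=\mathbb{Z}_2[\mathbb{A}^1]$, there are isomorphisms of $\mathbb{Z}_2$-algebras $$\mathbb{O}/\mathbb{R}[n]\ \simeq\ \mathrm{End}_{V}(n,n)=\mathrm{Hom}_{\mathbb{Z}_2}(V^{\otimes n},V^{\otimes n}),\qquad n\in\mathbb{N},$$ which are equivariant for the right actions of the symmetric groups $S_n$.
   Context: $\mathbb{Z}_2=\{0,1\}$ is the field with two elements, $[n]=\{1,\dots,n\}$. For a finite set $x$, $\mathbb{Z}_2^x$ is the set of maps $x\to\mathbb{Z}_2$ and $\mathbb{Z}_2[\mathbb{A}^x]$ is the $\mathbb{Z}_2$-algebra of (regular, equivalently all) maps $\mathbb{Z}_2^x\to\mathbb{Z}_2$ with pointwise operations; $\mathbb{Z}_2[\mathbb{A}^n]$ means $\mathbb{Z}_2[\mathbb{A}^{[n]}]$. Each $a\in x$ defines the coordinate function $g\mapsto g(a)$, and the Boolean partial derivative along $a$ is $(\partial_af)(g)=f(g+e_a)+f(g)$, where $e_a$ is the indicator function of $\{a\}$. Operators (words): let $\widetilde x=\{\widetilde a\mid a\in x\}$ be a disjoint copy of $x$. The set $\mathbb{O}(x)$ is defined recursively as the set of formal words with $x\sqcup\widetilde x\subseteq\mathbb{O}(x)$, $0,1\in\mathbb{O}(x)$, and if $p,q\in\mathbb{O}(x)$ then the words $(pq)$ and $(p+q)$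 are in $\mathbb{O}(x)$. The valuation map $\widehat{(\ )}:\mathbb{O}(x)\to\mathrm{End}_{\mathbb{Z}_2}(\mathbb{Z}_2[\mathbb{A}^x])$ is defined by: $\widehat a$ is multiplication by the coordinate function of $a$, $\widehat{\widetilde a}=\partial_a$ for $a\in x$, $\widehat{p+q}=\widehat p+\widehat q$, $\widehat{pq}=\widehat p\,\widehat q$ (composition), $\widehat 0=0$, $\widehat 1=\mathrm{id}$. The equivalence relation $\mathbb{R}(x)$ is: $p\,\mathbb{R}(x)\,q$ iff $\widehat p=\widehat q$. $\mathbb{O}/\mathbb{R}(x)=\mathbb{O}(x)/\mathbb{R}(x)$ with the induced sum, product and constants, which make it a $\mathbb{Z}_2$-algebra; this is a functor on the category $\mathbb{B}$ of finite sets and bijections by renaming letters ($a\mapsto\sigma(a)$, $\widetilde a\mapsto\widetilde{\sigma(a)}$). $\mathbb{O}/\mathbb{R}[n]$ is its value at $[n]$. A functor on $\mathbb{B}$ is the same as a sequence of objects with right $S_n$-actions ($S$-collection): here $\alpha\in S_n$ acts on the right on $\mathbb{O}/\mathbb{R}[n]$ by renaming $i\mapsto\alpha^{-1}(i)$, $\widetilde i\mapsto\widetilde{\alpha^{-1}(i)}$. For a $\mathbb{Z}_2$-vector space $V$, the prop $\mathrm{End}_V$ has morphism spaces $\mathrm{End}_V(n,m)=\mathrm{Hom}_{\mathbb{Z}_2}(V^{\otimes n},V^{\otimes m})$. Its diagonal part $\{\mathrm{End}_V(n,n)\}_n$ is an $S$-collection of algebras (product is composition) with right action $f\alpha=\alpha\circ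 f\circ\alpha^{-1}$, where $\alpha\in S_n$ acts on $V^{\otimes n}$ by the permutation $v_1\otimes\cdots\otimes v_n\mapsto v_{\alpha 1}\otimes\cdots\otimes v_{\alpha n}$. "Boole-Weyl algebra" refers to the $\mathbb{Z}_2$-algebra with generators $x_i,y_i$, $i\in[n]$, and relations $x_i^2=x_i$, $y_i^2=0$, $y_ix_i=x_iy_i+y_i+1$, $x_ix_j=x_jx_i$, $y_iy_j=y_jy_i$, and $y_ix_j=x_jy_i$ for $i\neq j$. *)

theory Defs
  imports
    "HOL-Algebra.Module"
    "HOL-Algebra.QuotRing"
    "HOL-Algebra.Algebraic_Closure_Type"
    "HOL-Library.Z2"
    "HOL-Combinatorics.Permutations"
begin

section \<open>Algebras over a commutative ring and their isomorphisms\<close>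

text \<open>The locale \<^locale>\<open>algebra\<close> of the library demands commutativity, so it cannot be
  used for algebras of operators.\<close>

locale k_algebra = module K A + ring A for K (structure) and A (structure) +
  assumes smult_mult_left: "\<lbrakk>c \<in> carrier K; x \<in> carrier A; y \<in> carrier A\<rbrakk>
      \<Longrightarrow> (c \<odot>\<^bsub>A\<^esub> x) \<otimes>\<^bsub>A\<^esub> y = c \<odot>\<^bsub>A\<^esub> (x \<otimes>\<^bsub>A\<^esub> y)"
    and smult_mult_right: "\<lbrakk>c \<in> carrier K; x \<in> carrier A; y \<in> carrier A\<rbrakk>
      \<Longrightarrow> x \<otimes>\<^bsub>A\<^esub> (c \<odot>\<^bsub>A\<^esub> y) = c \<odot>\<^bsub>A\<^esub> (x \<otimes>\<^bsub>A\<^esub> y)"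

definition alg_iso ::
  "('k, 'r) ring_scheme \<Rightarrow> ('k, 'a) module \<Rightarrow> ('k, 'b) module \<Rightarrow> ('a \<Rightarrow> 'b) \<Rightarrow> bool" where
  "alg_iso K A B h \<longleftrightarrow> k_algebra K A \<and> k_algebra K B \<and> h \<in> ring_iso A B \<and>
     (\<forall>c\<in>carrier K. \<forall>x\<in>carrier A. h (c \<odot>\<^bsub>A\<^esub> x) = c \<odot>\<^bsub>B\<^esub> h x)"

text \<open>Linear maps are extensional outside the carrier, so that equal maps are equal functions.\<close>

definition lin_maps :: "('k, 'r) ring_scheme \<Rightarrow> ('k, 'a) module \<Rightarrow> ('k, 'b) module \<Rightarrow> ('a \<Rightarrow> 'b) set" where
  "lin_maps K M N = {f \<in> carrier M \<rightarrow>\<^sub>E carrier N.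
     (\<forall>x\<in>carrier M. \<forall>y\<in>carrier M. f (x \<oplus>\<^bsub>M\<^esub> y) = f x \<oplus>\<^bsub>N\<^esub> f y) \<and>
     (\<forall>c\<in>carrier K. \<forall>x\<in>carrier M. f (c \<odot>\<^bsub>M\<^esub> x) = c \<odot>\<^bsub>N\<^esub> f x)}"

definition End_alg :: "('k, 'r) ring_scheme \<Rightarrow> ('k, 'a) module \<Rightarrow> ('k, 'a \<Rightarrow> 'a) module" where
  "End_alg K M =
    \<lparr>carrier = lin_maps K M M,
     monoid.mult = compose (carrier M),
     one = (\<lambda>x\<in>carrier M. x),
     ring.zero = (\<lambda>x\<in>carrier M. \<zero>\<^bsub>M\<^esub>),
     add = (\<lambda>f g. \<lambda>x\<in>carrier M. f x \<oplus>\<^bsub>M\<^esub> g x),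
     module.smult = (\<lambda>c f. \<lambda>x\<in>carrier M. c \<odot>\<^bsub>M\<^esub> f x)\<rparr>"

section \<open>The field with two elements and Boolean functions\<close>

abbreviation Z2 :: "bit ring" where
  "Z2 \<equiv> ring_of_type_algebra"

abbreviation cube :: "'a set \<Rightarrow> ('a \<Rightarrow> bit) set" where
  "cube x \<equiv> x \<rightarrow>\<^sub>E UNIV"

definition bool_fun :: "'a set \<Rightarrow> (bit, ('a \<Rightarrow> bit) \<Rightarrow> bit) module" where
  "bool_fun x =
    \<lparr>carrier = cube x \<rightarrow>\<^sub>E UNIV,
     monoid.mult = (\<lambda>f h. \<lambda>g\<in>cube x. f g * h g),
     one = (\<lambda>g\<in>cube x. 1),
     ring.zero = (\<lambda>g\<in>cube x. 0),
     add = (\<lambda>f h. \<lambda>g\<in>cube x. f g + h g),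
     module.smult = (\<lambda>c f. \<lambda>g\<in>cube x. c * f g)\<rparr>"

definition coord :: "'a set \<Rightarrow> 'a \<Rightarrow> ('a \<Rightarrow> bit) \<Rightarrow> bit" where
  "coord x a = (\<lambda>g\<in>cube x. g a)"

definition unit_vec :: "'a set \<Rightarrow> 'a \<Rightarrow> 'a \<Rightarrow> bit" where
  "unit_vec x a = (\<lambda>b\<in>x. if b = a then 1 else 0)"

definition bool_deriv :: "'a set \<Rightarrow> 'a \<Rightarrow> (('a \<Rightarrow> bit) \<Rightarrow> bit) \<Rightarrow> ('a \<Rightarrow> bit) \<Rightarrow> bit" where
  "bool_deriv x a f = (\<lambda>g\<in>cube x. f (\<lambda>b\<in>x. g b + unit_vec x a b) + f g)"

section \<open>Operator words and the functor of operators modulo equality of valuations\<close>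

text \<open>\<open>Dv a\<close> is the letter with a tilde; \<open>Wzero\<close>, \<open>Wone\<close> are the words 0, 1.\<close>

datatype 'a opword =
    Co 'a | Dv 'a | Wzero | Wone | Wmult "'a opword" "'a opword" | Wadd "'a opword" "'a opword"

inductive_set ops :: "'a set \<Rightarrow> 'a opword set" for x where
  "a \<in> x \<Longrightarrow> Co a \<in> ops x"
| "a \<in> x \<Longrightarrow> Dv a \<in> ops x"
| "Wzero \<in> ops x"
| "Wone \<in> ops x"
| "\<lbrakk>p \<in> ops x; q \<in> ops x\<rbrakk> \<Longrightarrow> Wmult p q \<in> ops x"
| "\<lbrakk>p \<in> ops x; q \<in> ops x\<rbrakk> \<Longrightarrow> Wadd p q \<in> ops x"

primrec val :: "'a set \<Rightarrow> 'a opword \<Rightarrow> (('a \<Rightarrow> bit) \<Rightarrow> bit) \<Rightarrow> ('a \<Rightarrow> bit) \<Rightarrow> bit" where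
  "val x (Co a) = (\<lambda>f\<in>carrier (bool_fun x). coord x a \<otimes>\<^bsub>bool_fun x\<^esub> f)"
| "val x (Dv a) = (\<lambda>f\<in>carrier (bool_fun x). bool_deriv x a f)"
| "val x Wzero = \<zero>\<^bsub>End_alg Z2 (bool_fun x)\<^esub>"
| "val x Wone = \<one>\<^bsub>End_alg Z2 (bool_fun x)\<^esub>"
| "val x (Wmult p q) = val x p \<otimes>\<^bsub>End_alg Z2 (bool_fun x)\<^esub> val x q"
| "val x (Wadd p q) = val x p \<oplus>\<^bsub>End_alg Z2 (bool_fun x)\<^esub> val x q"

definition op_rel :: "'a set \<Rightarrow> ('a opword \<times> 'a opword) set" where
  "op_rel x = {(p, q). p \<in> ops x \<and> q \<in> ops x \<and> val x p = val x q}"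

text \<open>The quotient of the words by a congruence \<open>R\<close>, with the induced operations.\<close>

definition word_quot :: "'a set \<Rightarrow> ('a opword \<times> 'a opword) set \<Rightarrow> (bit, 'a opword set) module" where
  "word_quot x R =
    \<lparr>carrier = ops x // R,
     monoid.mult = (\<lambda>P Q. \<Union>p\<in>P. \<Union>q\<in>Q. R `` {Wmult p q}),
     one = R `` {Wone},
     ring.zero = R `` {Wzero},
     add = (\<lambda>P Q. \<Union>p\<in>P. \<Union>q\<in>Q. R `` {Wadd p q}),
     module.smult = (\<lambda>c P. if c = 0 then R `` {Wzero} else P)\<rparr>"

definition OR :: "'a set \<Rightarrow> (bit, 'a opword set) module" where
  "OR x = word_quot x (op_rel x)"

text \<open>Functoriality: a bijection \<open>\<sigma>\<close> from \<open>x\<close> to \<open>y\<close> renames the letters in all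
  representatives of a class; \<open>OR_map y \<sigma>\<close> is the induced map from \<open>OR x\<close> to \<open>OR y\<close>.\<close>

definition OR_map :: "'b set \<Rightarrow> ('a \<Rightarrow> 'b) \<Rightarrow> 'a opword set \<Rightarrow> 'b opword set" where
  "OR_map y \<sigma> P = (\<Union>p\<in>P. op_rel y `` {map_opword \<sigma> p})"

text \<open>The right action of \<open>S\<^sub>n\<close> renames \<open>i\<close> to \<open>\<alpha>\<^sup>-\<^sup>1(i)\<close>.\<close>

definition OR_act :: "nat \<Rightarrow> nat opword set \<Rightarrow> (nat \<Rightarrow> nat) \<Rightarrow> nat opword set" where
  "OR_act n P \<alpha> = OR_map {1..n} (inv_into UNIV \<alpha>) P"

section \<open>Tensor powers\<close>

text \<open>Quotient of a module by a submodule. The library quotient supplies the cosets and their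
  addition; its multiplication is meaningless here and is not used.\<close>

definition quot_mod :: "('k, 'a) module \<Rightarrow> 'a set \<Rightarrow> ('k, 'a set) module" where
  "quot_mod M N = ring.extend (M Quot N)
     (module.fields (\<lambda>c C. \<Union>x\<in>C. N +>\<^bsub>M\<^esub> (c \<odot>\<^bsub>M\<^esub> x)))"

text \<open>The free module on a set \<open>S\<close>: finitely supported functions, zero off \<open>S\<close>.\<close>

definition free_mod :: "('k, 'r) ring_scheme \<Rightarrow> 's set \<Rightarrow> ('k, 's \<Rightarrow> 'k) module" where
  "free_mod K S =
    \<lparr>carrier = {f. (\<forall>s. f s \<in> carrier K) \<and> finite {s. f s \<noteq> \<zero>\<^bsub>K\<^esub>} \<and> {s. f s \<noteq> \<zero>\<^bsub>K\<^esub>} \<subseteq> S},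
     monoid.mult = undefined,
     one = undefined,
     ring.zero = (\<lambda>_. \<zero>\<^bsub>K\<^esub>),
     add = (\<lambda>f g s. f s \<oplus>\<^bsub>K\<^esub> g s),
     module.smult = (\<lambda>c f s. c \<otimes>\<^bsub>K\<^esub> f s)\<rparr>"

definition free_gen :: "('k, 'r) ring_scheme \<Rightarrow> 's \<Rightarrow> 's \<Rightarrow> 'k" where
  "free_gen K t = (\<lambda>s. if s = t then \<one>\<^bsub>K\<^esub> else \<zero>\<^bsub>K\<^esub>)"

abbreviation tuples :: "('k, 'v) module \<Rightarrow> nat \<Rightarrow> (nat \<Rightarrow> 'v) set" where
  "tuples M n \<equiv> {1..n} \<rightarrow>\<^sub>E carrier M"

abbreviation tuple_mod :: "('k, 'r) ring_scheme \<Rightarrow> ('k, 'v) module \<Rightarrow> nat \<Rightarrow> ('k, (nat \<Rightarrow> 'v) \<Rightarrow> 'k) module" where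
  "tuple_mod K M n \<equiv> free_mod K (tuples M n)"

definition multilinear_rels ::
  "('k, 'r) ring_scheme \<Rightarrow> ('k, 'v) module \<Rightarrow> nat \<Rightarrow> ((nat \<Rightarrow> 'v) \<Rightarrow> 'k) set" where
  "multilinear_rels K M n =
     {free_gen K (t(i := u \<oplus>\<^bsub>M\<^esub> v)) \<ominus>\<^bsub>tuple_mod K M n\<^esub>
        (free_gen K (t(i := u)) \<oplus>\<^bsub>tuple_mod K M n\<^esub> free_gen K (t(i := v)))
      | t i u v. t \<in> tuples M n \<and> i \<in> {1..n} \<and> u \<in> carrier M \<and> v \<in> carrier M}
   \<union> {free_gen K (t(i := c \<odot>\<^bsub>M\<^esub> u)) \<ominus>\<^bsub>tuple_mod K M n\<^esub>
        (c \<odot>\<^bsub>tuple_mod K M n\<^esub> free_gen K (t(i := u)))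
      | t i c u. t \<in> tuples M n \<and> i \<in> {1..n} \<and> c \<in> carrier K \<and> u \<in> carrier M}"

definition multilinear_submod ::
  "('k, 'r) ring_scheme \<Rightarrow> ('k, 'v) module \<Rightarrow> nat \<Rightarrow> ((nat \<Rightarrow> 'v) \<Rightarrow> 'k) set" where
  "multilinear_submod K M n =
     \<Inter>{N. submodule N K (tuple_mod K M n) \<and> multilinear_rels K M n \<subseteq> N}"

definition tensor_pow ::
  "('k, 'r) ring_scheme \<Rightarrow> ('k, 'v) module \<Rightarrow> nat \<Rightarrow> ('k, ((nat \<Rightarrow> 'v) \<Rightarrow> 'k) set) module" where
  "tensor_pow K M n = quot_mod (tuple_mod K M n) (multilinear_submod K M n)"

definition pure_tensor ::
  "('k, 'r) ring_scheme \<Rightarrow> ('k, 'v) module \<Rightarrow> nat \<Rightarrow> (nat \<Rightarrow> 'v) \<Rightarrow> ((nat \<Rightarrow> 'v) \<Rightarrow> 'k) set" where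
  "pure_tensor K M n t = multilinear_submod K M n +>\<^bsub>tuple_mod K M n\<^esub> free_gen K t"

section \<open>The endomorphism prop and its diagonal\<close>

definition End_prop ::
  "('k, 'r) ring_scheme \<Rightarrow> ('k, 'v) module \<Rightarrow> nat \<Rightarrow> nat
    \<Rightarrow> (((nat \<Rightarrow> 'v) \<Rightarrow> 'k) set \<Rightarrow> ((nat \<Rightarrow> 'v) \<Rightarrow> 'k) set) set" where
  "End_prop K M n m = lin_maps K (tensor_pow K M n) (tensor_pow K M m)"

text \<open>The algebra of endomorphisms with carrier \<open>End_prop K M n n\<close>.\<close>

definition End_diag ::
  "('k, 'r) ring_scheme \<Rightarrow> ('k, 'v) module \<Rightarrow> nat
    \<Rightarrow> ('k, ((nat \<Rightarrow> 'v) \<Rightarrow> 'k) set \<Rightarrow> ((nat \<Rightarrow> 'v) \<Rightarrow> 'k) set) module" where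
  "End_diag K M n = End_alg K (tensor_pow K M n)"

lemma carrier_End_diag: "carrier (End_diag K M n) = End_prop K M n n"
  by (simp add: End_diag_def End_alg_def End_prop_def)

text \<open>The operator \<open>v\<^sub>1 \<otimes> \<dots> \<otimes> v\<^sub>n \<mapsto> v\<^bsub>\<alpha> 1\<^esub> \<otimes> \<dots> \<otimes> v\<^bsub>\<alpha> n\<^esub>\<close>; the linear map is unique because
  pure tensors generate the tensor power.\<close>

definition perm_op ::
  "('k, 'r) ring_scheme \<Rightarrow> ('k, 'v) module \<Rightarrow> nat \<Rightarrow> (nat \<Rightarrow> nat)
    \<Rightarrow> ((nat \<Rightarrow> 'v) \<Rightarrow> 'k) set \<Rightarrow> ((nat \<Rightarrow> 'v) \<Rightarrow> 'k) set" where
  "perm_op K M n \<alpha> = (THE h. h \<in> End_prop K M n n \<and>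
     (\<forall>t\<in>tuples M n. h (pure_tensor K M n t) = pure_tensor K M n (\<lambda>i\<in>{1..n}. t (\<alpha> i))))"

definition End_act ::
  "('k, 'r) ring_scheme \<Rightarrow> ('k, 'v) module \<Rightarrow> nat
    \<Rightarrow> (((nat \<Rightarrow> 'v) \<Rightarrow> 'k) set \<Rightarrow> ((nat \<Rightarrow> 'v) \<Rightarrow> 'k) set) \<Rightarrow> (nat \<Rightarrow> nat)
    \<Rightarrow> ((nat \<Rightarrow> 'v) \<Rightarrow> 'k) set \<Rightarrow> ((nat \<Rightarrow> 'v) \<Rightarrow> 'k) set" where
  "End_act K M n f \<alpha> =
     perm_op K M n \<alpha> \<otimes>\<^bsub>End_diag K M n\<^esub> f \<otimes>\<^bsub>End_diag K M n\<^esub> perm_op K M n (inv_into UNIV \<alpha>)"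

section \<open>The Boole-Weyl algebra\<close>

text \<open>Presentation by generators \<open>x\<^sub>i = Co i\<close>, \<open>y\<^sub>i = Dv i\<close>: the words modulo the least
  congruence containing the axioms of an associative unital algebra over the field with two
  elements and the defining relations. Rule \<open>add_self\<close> expresses characteristic two and provides
  the additive inverses.\<close>

inductive_set bw_rel :: "'a set \<Rightarrow> ('a opword \<times> 'a opword) set" for x where
  refl: "p \<in> ops x \<Longrightarrow> (p, p) \<in> bw_rel x"
| sym: "(p, q) \<in> bw_rel x \<Longrightarrow> (q, p) \<in> bw_rel x"
| trans: "\<lbrakk>(p, q) \<in> bw_rel x; (q, r) \<in> bw_rel x\<rbrakk> \<Longrightarrow> (p, r) \<in> bw_rel x"
| cong_add: "\<lbrakk>(p, p') \<in> bw_rel x; (q, q') \<in> bw_rel x\<rbrakk> \<Longrightarrow> (Wadd p q, Wadd p' q') \<in> bw_rel x"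
| cong_mult: "\<lbrakk>(p, p') \<in> bw_rel x; (q, q') \<in> bw_rel x\<rbrakk> \<Longrightarrow> (Wmult p q, Wmult p' q') \<in> bw_rel x"
| add_assoc: "\<lbrakk>p \<in> ops x; q \<in> ops x; r \<in> ops x\<rbrakk>
    \<Longrightarrow> (Wadd (Wadd p q) r, Wadd p (Wadd q r)) \<in> bw_rel x"
| add_comm: "\<lbrakk>p \<in> ops x; q \<in> ops x\<rbrakk> \<Longrightarrow> (Wadd p q, Wadd q p) \<in> bw_rel x"
| add_zero: "p \<in> ops x \<Longrightarrow> (Wadd Wzero p, p) \<in> bw_rel x"
| add_self: "p \<in> ops x \<Longrightarrow> (Wadd p p, Wzero) \<in> bw_rel x"
| mult_assoc: "\<lbrakk>p \<in> ops x; q \<in> ops x; r \<in> ops x\<rbrakk>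
    \<Longrightarrow> (Wmult (Wmult p q) r, Wmult p (Wmult q r)) \<in> bw_rel x"
| mult_one_left: "p \<in> ops x \<Longrightarrow> (Wmult Wone p, p) \<in> bw_rel x"
| mult_one_right: "p \<in> ops x \<Longrightarrow> (Wmult p Wone, p) \<in> bw_rel x"
| distrib_left: "\<lbrakk>p \<in> ops x; q \<in> ops x; r \<in> ops x\<rbrakk>
    \<Longrightarrow> (Wmult p (Wadd q r), Wadd (Wmult p q) (Wmult p r)) \<in> bw_rel x"
| distrib_right: "\<lbrakk>p \<in> ops x; q \<in> ops x; r \<in> ops x\<rbrakk>
    \<Longrightarrow> (Wmult (Wadd p q) r, Wadd (Wmult p r) (Wmult q r)) \<in> bw_rel x"
| x_idem: "i \<in> x \<Longrightarrow> (Wmult (Co i) (Co i), Co i) \<in> bw_rel x"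
| y_nil: "i \<in> x \<Longrightarrow> (Wmult (Dv i) (Dv i), Wzero) \<in> bw_rel x"
| y_x: "i \<in> x \<Longrightarrow>
    (Wmult (Dv i) (Co i), Wadd (Wadd (Wmult (Co i) (Dv i)) (Dv i)) Wone) \<in> bw_rel x"
| x_x_comm: "\<lbrakk>i \<in> x; j \<in> x\<rbrakk> \<Longrightarrow> (Wmult (Co i) (Co j), Wmult (Co j) (Co i)) \<in> bw_rel x"
| y_y_comm: "\<lbrakk>i \<in> x; j \<in> x\<rbrakk> \<Longrightarrow> (Wmult (Dv i) (Dv j), Wmult (Dv j) (Dv i)) \<in> bw_rel x"
| y_x_comm: "\<lbrakk>i \<in> x; j \<in> x; i \<noteq> j\<rbrakk>
    \<Longrightarrow> (Wmult (Dv i) (Co j), Wmult (Co j) (Dv i)) \<in> bw_rel x"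

definition boole_weyl :: "nat \<Rightarrow> (bit, nat opword set) module" where
  "boole_weyl n = word_quot {1..n} (bw_rel {1..n})"

definition is_boole_weyl :: "nat \<Rightarrow> (bit, 'a) module \<Rightarrow> bool" where
  "is_boole_weyl n A \<longleftrightarrow> (\<exists>h. alg_iso Z2 (boole_weyl n) A h)"

end

theory Submission
  imports Defs
begin

text \<open>
  Everything rests on one computation. On Boolean functions \<open>\<partial>\<^sub>a + 1\<close> is the shift
  \<open>f(g) \<mapsto> f(g + e\<^sub>a)\<close>, while the coordinate of \<open>a\<close> and its complement are the projections onto
  the functions supported where \<open>g(a) = 1\<close> and where \<open>g(a) = 0\<close>. Multiplying, over all letters
  \<open>a\<close>, the projection to the value \<open>u(a)\<close> by the shift by \<open>u(a) + v(a)\<close> therefore gives the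
  matrix unit that sends \<open>f\<close> to \<open>f(v)\<close> times the indicator of the point \<open>u\<close>
  (\<open>val_unit_word_full\<close>). All matrix units being values of words, every linear endomorphism of
  the functions on the cube is one (\<open>val_surj\<close>).

  The Boole-Weyl relations suffice for the multiplication rules of these matrix units: in any
  ring that satisfies the relations, left multiplication by a generator acts on the column
  \<open>u \<mapsto> E\<^sub>u\<^sub>v\<close> (for fixed \<open>v\<close>) as the operator of that generator acts on functions
  (\<open>eval_word_column\<close>). A word with the operator zero thus annihilates all diagonal matrix
  units; they add up to one, so it evaluates to zero (\<open>eval_word_cong\<close>). Hence the relation
  defined by the presentation is equality of operators (\<open>op_rel_eq_bw_rel\<close>), and the words modulo
  this relation are both the Boole-Weyl algebra and the algebra of all endomorphisms of the
  functions on the cube (\<open>OR_iso_End_bool_fun\<close>).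

  It remains to identify the functions on the \<open>n\<close>-cube with the tensor power of the functions on
  one bit, by multiplying out: \<open>v\<^sub>1 \<otimes> \<dots> \<otimes> v\<^sub>n\<close> becomes \<open>g \<mapsto> v\<^sub>1(g\<^sub>1) \<cdots> v\<^sub>n(g\<^sub>n)\<close>. The
  kernel on the free module over the tuples consists of the multilinear relations only, because
  modulo these every tuple expands into tuples of indicator functions, which are mapped to a basis
  (\<open>multilinear_submod_eq_kernel\<close>). Conjugation by the resulting isomorphism
  (\<open>tensor_pow_iso\<close>) carries one endomorphism algebra to the other. Under it, permuting the tensor
  factors is reindexing the coordinates of the cube (\<open>perm_op_eq_conj\<close>), and renaming the letters
  of a word conjugates its operator by this reindexing (\<open>val_map_opword\<close>), which is the
  equivariance.
\<close>

section \<open>Arithmetic of bits\<close>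

lemma Z2_simps [simp]:
  "carrier Z2 = UNIV" "monoid.mult Z2 = (*)" "one Z2 = 1" "ring.zero Z2 = 0" "add Z2 = (+)"
  by (simp_all only: ring_of_type_algebra_def partial_object.simps monoid.simps ring.simps)

lemma cring_Z2: "cring Z2"
  by (rule cring_from_type_algebra)

lemma bit_add_self [simp]: "(b::bit) + b = 0"
  by (cases b) simp_all

lemma bit_add_self_left [simp]: "(b::bit) + (b + c) = c"
  by (simp only: add.assoc [symmetric] bit_add_self add_0_left)

lemma finite_UNIV_bit: "finite (UNIV :: bit set)"
  by (rule finite_subset[of _ "{0, 1}"]) (use bit_not_zero_iff in auto)

text \<open>These rules turn sums and products of bits into Boolean connectives; the computations below
  are done in the field instead.\<close>
declare add_bit_eq_xor [simp del] mult_bit_eq_and [simp del]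

section \<open>Transport of structure along bijections\<close>

text \<open>A bijection onto a module that respects the operations pulls the module axioms back; the
  quotients below obtain their structure in this way, without arguing about representatives.\<close>
lemma module_pullback:
  fixes h :: "'a \<Rightarrow> 'b"
  assumes B: "module K B" and bij: "bij_betw h (carrier A) (carrier B)"
    and closed: "\<And>x y. x \<in> carrier A \<Longrightarrow> y \<in> carrier A \<Longrightarrow> x \<oplus>\<^bsub>A\<^esub> y \<in> carrier A"
      "\<zero>\<^bsub>A\<^esub> \<in> carrier A"
      "\<And>c x. c \<in> carrier K \<Longrightarrow> x \<in> carrier A \<Longrightarrow> c \<odot>\<^bsub>A\<^esub> x \<in> carrier A"
    and hom: "\<And>x y. x \<in> carrier A \<Longrightarrow> y \<in> carrier A \<Longrightarrow> h (x \<oplus>\<^bsub>A\<^esub> y) = h x \<oplus>\<^bsub>B\<^esub> h y"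
      "h \<zero>\<^bsub>A\<^esub> = \<zero>\<^bsub>B\<^esub>"
      "\<And>c x. c \<in> carrier K \<Longrightarrow> x \<in> carrier A \<Longrightarrow> h (c \<odot>\<^bsub>A\<^esub> x) = c \<odot>\<^bsub>B\<^esub> h x"
  shows "module K A"
proof -
  interpret B: module K B by fact
  have hB [simp, intro]: "x \<in> carrier A \<Longrightarrow> h x \<in> carrier B" for x
    using bij by (auto simp: bij_betw_def)
  have inj: "x = y" if "h x = h y" "x \<in> carrier A" "y \<in> carrier A" for x y
    using bij that by (auto simp: bij_betw_def inj_on_def)
  have neg: "\<exists>y\<in>carrier A. y \<oplus>\<^bsub>A\<^esub> x = \<zero>\<^bsub>A\<^esub>" if x: "x \<in> carrier A" for x
  proof -
    have "\<ominus>\<^bsub>B\<^esub> h x \<in> carrier B" using x by simp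
    then obtain y where y: "y \<in> carrier A" "h y = \<ominus>\<^bsub>B\<^esub> h x"
      using bij by (metis bij_betw_imp_surj_on imageE)
    then have "y \<oplus>\<^bsub>A\<^esub> x = \<zero>\<^bsub>A\<^esub>"
      by (intro inj) (simp_all add: closed hom x B.M.l_neg)
    with y show ?thesis by blast
  qed
  have "abelian_group A"
    using neg
    by (intro abelian_groupI; (intro inj)?)
      (auto simp: closed hom B.M.a_ac)
  then show ?thesis
    by (intro moduleI B.R.is_cring; (intro inj)?)
      (simp_all add: closed hom B.smult_l_distr B.smult_r_distr B.smult_assoc1)
qed

lemma alg_iso_pullback:
  fixes h :: "'a \<Rightarrow> 'b"
  assumes B: "k_algebra K B" and bij: "bij_betw h (carrier A) (carrier B)"
    and closed: "\<And>x y. x \<in> carrier A \<Longrightarrow> y \<in> carrier A \<Longrightarrow> x \<otimes>\<^bsub>A\<^esub> y \<in> carrier A"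
      "\<And>x y. x \<in> carrier A \<Longrightarrow> y \<in> carrier A \<Longrightarrow> x \<oplus>\<^bsub>A\<^esub> y \<in> carrier A"
      "\<one>\<^bsub>A\<^esub> \<in> carrier A" "\<zero>\<^bsub>A\<^esub> \<in> carrier A"
      "\<And>c x. c \<in> carrier K \<Longrightarrow> x \<in> carrier A \<Longrightarrow> c \<odot>\<^bsub>A\<^esub> x \<in> carrier A"
    and hom: "\<And>x y. x \<in> carrier A \<Longrightarrow> y \<in> carrier A \<Longrightarrow> h (x \<otimes>\<^bsub>A\<^esub> y) = h x \<otimes>\<^bsub>B\<^esub> h y"
      "\<And>x y. x \<in> carrier A \<Longrightarrow> y \<in> carrier A \<Longrightarrow> h (x \<oplus>\<^bsub>A\<^esub> y) = h x \<oplus>\<^bsub>B\<^esub> h y"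
      "h \<one>\<^bsub>A\<^esub> = \<one>\<^bsub>B\<^esub>" "h \<zero>\<^bsub>A\<^esub> = \<zero>\<^bsub>B\<^esub>"
      "\<And>c x. c \<in> carrier K \<Longrightarrow> x \<in> carrier A \<Longrightarrow> h (c \<odot>\<^bsub>A\<^esub> x) = c \<odot>\<^bsub>B\<^esub> h x"
  shows "alg_iso K A B h"
proof -
  interpret B: k_algebra K B by fact
  have hB [simp, intro]: "x \<in> carrier A \<Longrightarrow> h x \<in> carrier B" for x
    using bij by (auto simp: bij_betw_def)
  have inj: "x = y" if "h x = h y" "x \<in> carrier A" "y \<in> carrier A" for x y
    using bij that by (auto simp: bij_betw_def inj_on_def)
  have mod: "module K A"
    by (rule module_pullback[OF B.module_axioms bij]) (simp_all add: closed hom)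
  have mon: "Group.monoid A"
    by (intro monoidI; (intro inj)?) (simp_all add: closed hom B.m_assoc)
  have ring: "ring A"
    by (intro ringI module.axioms(2)[OF mod] mon; (intro inj)?)
      (simp_all add: closed hom B.l_distr B.r_distr)
  have "k_algebra K A"
    using mod ring
    by (intro k_algebra.intro k_algebra_axioms.intro; (intro inj)?)
      (simp_all add: closed hom B.smult_mult_left B.smult_mult_right)
  then show ?thesis
    unfolding alg_iso_def using B bij hom by (auto intro!: ring_iso_memI)
qed

lemma k_algebra_if_alg_iso: "alg_iso K A B h \<Longrightarrow> k_algebra K A"
  by (simp add: alg_iso_def)

lemma alg_iso_trans:
  assumes "alg_iso K A B h" "alg_iso K B C k"
  shows "alg_iso K A C (k \<circ> h)"
proof -
  have "h x \<in> carrier B" if "x \<in> carrier A" for x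
    using assms(1) that by (auto simp: alg_iso_def dest: ring_iso_memE(1))
  then show ?thesis
    using assms ring_iso_set_trans[of h A B k C] by (auto simp: alg_iso_def)
qed

lemma alg_iso_refl: "k_algebra K A \<Longrightarrow> alg_iso K A A (\<lambda>x. x)"
  by (auto simp: alg_iso_def intro!: ring_iso_memI bij_betwI')

section \<open>Linear maps and endomorphism algebras\<close>

lemma lin_mapsI:
  assumes "\<And>x. x \<in> carrier M \<Longrightarrow> f x \<in> carrier N"
    "\<And>x. x \<notin> carrier M \<Longrightarrow> f x = undefined"
    "\<And>x y. x \<in> carrier M \<Longrightarrow> y \<in> carrier M \<Longrightarrow> f (x \<oplus>\<^bsub>M\<^esub> y) = f x \<oplus>\<^bsub>N\<^esub> f y"
    "\<And>c x. c \<in> carrier K \<Longrightarrow> x \<in> carrier M \<Longrightarrow> f (c \<odot>\<^bsub>M\<^esub> x) = c \<odot>\<^bsub>N\<^esub> f x"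
  shows "f \<in> lin_maps K M N"
  using assms by (auto simp: lin_maps_def PiE_def extensional_def)

lemma lin_mapsD:
  assumes "f \<in> lin_maps K M N"
  shows "x \<in> carrier M \<Longrightarrow> f x \<in> carrier N"
    "x \<notin> carrier M \<Longrightarrow> f x = undefined"
    "x \<in> carrier M \<Longrightarrow> y \<in> carrier M \<Longrightarrow> f (x \<oplus>\<^bsub>M\<^esub> y) = f x \<oplus>\<^bsub>N\<^esub> f y"
    "c \<in> carrier K \<Longrightarrow> x \<in> carrier M \<Longrightarrow> f (c \<odot>\<^bsub>M\<^esub> x) = c \<odot>\<^bsub>N\<^esub> f x"
  using assms by (auto simp: lin_maps_def PiE_def extensional_def)

text \<open>Extensionality off the carrier makes equality on the carrier enough.\<close>
lemma lin_maps_eqI: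
  assumes "f \<in> lin_maps K M N" "g \<in> lin_maps K M N" "\<And>x. x \<in> carrier M \<Longrightarrow> f x = g x"
  shows "f = g"
  using assms lin_mapsD(2)[of f K M N] lin_mapsD(2)[of g K M N] by (intro ext) metis

lemma lin_maps_compose:
  assumes "f \<in> lin_maps K M N" "g \<in> lin_maps K N P" "module K M"
  shows "compose (carrier M) g f \<in> lin_maps K M P"
proof -
  interpret module K M by fact
  show ?thesis
    by (intro lin_mapsI)
      (simp_all add: compose_def lin_mapsD[OF assms(1)] lin_mapsD[OF assms(2)])
qed

lemma lin_maps_zero:
  assumes "f \<in> lin_maps K M N" "module K M" "module K N"
  shows "f \<zero>\<^bsub>M\<^esub> = \<zero>\<^bsub>N\<^esub>"
proof -
  interpret M: module K M by fact
  interpret N: module K N by fact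
  have "f (\<zero>\<^bsub>K\<^esub> \<odot>\<^bsub>M\<^esub> \<zero>\<^bsub>M\<^esub>) = \<zero>\<^bsub>K\<^esub> \<odot>\<^bsub>N\<^esub> f \<zero>\<^bsub>M\<^esub>"
    by (intro lin_mapsD(4)[OF assms(1)]) simp_all
  then show ?thesis using lin_mapsD(1)[OF assms(1)] by simp
qed

lemma End_alg_simps [simp]:
  "carrier (End_alg K M) = lin_maps K M M"
  "f \<otimes>\<^bsub>End_alg K M\<^esub> g = compose (carrier M) f g"
  "\<one>\<^bsub>End_alg K M\<^esub> = (\<lambda>x\<in>carrier M. x)"
  "\<zero>\<^bsub>End_alg K M\<^esub> = (\<lambda>x\<in>carrier M. \<zero>\<^bsub>M\<^esub>)"
  "f \<oplus>\<^bsub>End_alg K M\<^esub> g = (\<lambda>x\<in>carrier M. f x \<oplus>\<^bsub>M\<^esub> g x)"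
  "c \<odot>\<^bsub>End_alg K M\<^esub> f = (\<lambda>x\<in>carrier M. c \<odot>\<^bsub>M\<^esub> f x)"
  by (simp_all add: End_alg_def)

lemma End_alg_closed:
  assumes M: "module K M"
  shows "f \<in> lin_maps K M M \<Longrightarrow> g \<in> lin_maps K M M \<Longrightarrow> compose (carrier M) f g \<in> lin_maps K M M"
    "f \<in> lin_maps K M M \<Longrightarrow> g \<in> lin_maps K M M \<Longrightarrow> (\<lambda>x\<in>carrier M. f x \<oplus>\<^bsub>M\<^esub> g x) \<in> lin_maps K M M"
    "(\<lambda>x\<in>carrier M. x) \<in> lin_maps K M M" "(\<lambda>x\<in>carrier M. \<zero>\<^bsub>M\<^esub>) \<in> lin_maps K M M"
    "f \<in> lin_maps K M M \<Longrightarrow> c \<in> carrier K \<Longrightarrow> (\<lambda>x\<in>carrier M. c \<odot>\<^bsub>M\<^esub> f x) \<in> lin_maps K M M"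
proof -
  interpret M: module K M by fact
  show "(\<lambda>x\<in>carrier M. x) \<in> lin_maps K M M" "(\<lambda>x\<in>carrier M. \<zero>\<^bsub>M\<^esub>) \<in> lin_maps K M M"
    by (auto intro!: lin_mapsI)
  assume f: "f \<in> lin_maps K M M"
  note f' = lin_mapsD[OF f]
  show "(\<lambda>x\<in>carrier M. c \<odot>\<^bsub>M\<^esub> f x) \<in> lin_maps K M M" if "c \<in> carrier K"
    using that
    by (intro lin_mapsI)
      (simp_all add: f' M.smult_r_distr M.smult_assoc1 [symmetric] M.R.m_comm)
  assume g: "g \<in> lin_maps K M M"
  note g' = lin_mapsD[OF g]
  show "compose (carrier M) f g \<in> lin_maps K M M"
    by (rule lin_maps_compose[OF g f M])
  show "(\<lambda>x\<in>carrier M. f x \<oplus>\<^bsub>M\<^esub> g x) \<in> lin_maps K M M"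
    by (intro lin_mapsI) (simp_all add: f' g' M.M.a_ac M.smult_r_distr)
qed

lemma k_algebra_End_alg:
  assumes "module K M"
  shows "k_algebra K (End_alg K M)"
proof -
  interpret M: module K M by fact
  note cl = End_alg_closed[OF assms]
  have cM: "f x \<in> carrier M" if "f \<in> lin_maps K M M" "x \<in> carrier M" for f x
    using that by (rule lin_mapsD)
  have add: "f (x \<oplus>\<^bsub>M\<^esub> y) = f x \<oplus>\<^bsub>M\<^esub> f y"
    if "f \<in> lin_maps K M M" "x \<in> carrier M" "y \<in> carrier M" for f x y
    using that by (rule lin_mapsD)
  have smult: "f (c \<odot>\<^bsub>M\<^esub> x) = c \<odot>\<^bsub>M\<^esub> f x"
    if "f \<in> lin_maps K M M" "c \<in> carrier K" "x \<in> carrier M" for f c x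
    using that by (rule lin_mapsD)
  have eq: "f = g"
    if "f \<in> extensional (carrier M)" "g \<in> extensional (carrier M)"
      "\<And>x. x \<in> carrier M \<Longrightarrow> f x = g x" for f g :: "'c \<Rightarrow> 'c"
    using that by (rule extensionalityI)
  have ex [simp]: "f \<in> extensional (carrier M)" if "f \<in> lin_maps K M M" for f
    using lin_mapsD(2)[OF that] by (auto simp: extensional_def)
  have minus: "\<exists>g\<in>lin_maps K M M. (\<lambda>x\<in>carrier M. g x \<oplus>\<^bsub>M\<^esub> f x) = (\<lambda>x\<in>carrier M. \<zero>\<^bsub>M\<^esub>)"
    if f: "f \<in> lin_maps K M M" for f
  proof (intro bexI restrict_ext)
    show "(\<lambda>x\<in>carrier M. (\<ominus>\<^bsub>K\<^esub> \<one>\<^bsub>K\<^esub>) \<odot>\<^bsub>M\<^esub> f x) \<in> lin_maps K M M"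
      using f by (intro cl) simp_all
  qed (use f in \<open>simp add: cM M.smult_l_minus M.M.l_neg\<close>)
  have ab: "abelian_group (End_alg K M)"
  proof (rule abelian_groupI, unfold End_alg_simps)
    fix f g h assume "f \<in> lin_maps K M M" "g \<in> lin_maps K M M" "h \<in> lin_maps K M M"
    then show "(\<lambda>x\<in>carrier M. (\<lambda>x\<in>carrier M. f x \<oplus>\<^bsub>M\<^esub> g x) x \<oplus>\<^bsub>M\<^esub> h x)
        = (\<lambda>x\<in>carrier M. f x \<oplus>\<^bsub>M\<^esub> (\<lambda>x\<in>carrier M. g x \<oplus>\<^bsub>M\<^esub> h x) x)"
      by (intro eq) (simp_all add: cM M.M.a_assoc)
  next
    fix f g assume "f \<in> lin_maps K M M" "g \<in> lin_maps K M M"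
    then show "(\<lambda>x\<in>carrier M. f x \<oplus>\<^bsub>M\<^esub> g x) = (\<lambda>x\<in>carrier M. g x \<oplus>\<^bsub>M\<^esub> f x)"
      by (intro eq) (simp_all add: cM M.M.a_comm)
  next
    fix f assume "f \<in> lin_maps K M M"
    then show "(\<lambda>x\<in>carrier M. (\<lambda>x\<in>carrier M. \<zero>\<^bsub>M\<^esub>) x \<oplus>\<^bsub>M\<^esub> f x) = f"
      by (intro eq) (simp_all add: cM)
  qed (assumption | rule cl minus)+
  have mon: "Group.monoid (End_alg K M)"
  proof (rule monoidI, unfold End_alg_simps)
    fix f g h assume "f \<in> lin_maps K M M" "g \<in> lin_maps K M M" "h \<in> lin_maps K M M"
    then show "compose (carrier M) (compose (carrier M) f g) h
        = compose (carrier M) f (compose (carrier M) g h)"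
      by (intro eq) (simp_all add: cM compose_def)
  next
    fix f assume "f \<in> lin_maps K M M"
    then show "compose (carrier M) (\<lambda>x\<in>carrier M. x) f = f"
      "compose (carrier M) f (\<lambda>x\<in>carrier M. x) = f"
      by (auto intro!: eq simp: cM compose_def)
  qed (use cl in blast)+
  have ring: "ring (End_alg K M)"
  proof (rule ringI[OF ab mon], unfold End_alg_simps)
    fix f g h assume *: "f \<in> lin_maps K M M" "g \<in> lin_maps K M M" "h \<in> lin_maps K M M"
    show "compose (carrier M) (\<lambda>x\<in>carrier M. f x \<oplus>\<^bsub>M\<^esub> g x) h =
        (\<lambda>x\<in>carrier M. compose (carrier M) f h x \<oplus>\<^bsub>M\<^esub> compose (carrier M) g h x)"
      "compose (carrier M) h (\<lambda>x\<in>carrier M. f x \<oplus>\<^bsub>M\<^esub> g x) =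
        (\<lambda>x\<in>carrier M. compose (carrier M) h f x \<oplus>\<^bsub>M\<^esub> compose (carrier M) h g x)"
      using * by (auto intro!: eq simp: cM compose_def add[OF *(3)])
  qed
  have mod: "module K (End_alg K M)"
  proof (rule moduleI[OF M.R.is_cring ab], unfold End_alg_simps)
    fix c d f g assume *: "c \<in> carrier K" "d \<in> carrier K" "f \<in> lin_maps K M M"
    show "(\<lambda>x\<in>carrier M. (c \<oplus>\<^bsub>K\<^esub> d) \<odot>\<^bsub>M\<^esub> f x) =
        (\<lambda>x\<in>carrier M. (\<lambda>x\<in>carrier M. c \<odot>\<^bsub>M\<^esub> f x) x \<oplus>\<^bsub>M\<^esub> (\<lambda>x\<in>carrier M. d \<odot>\<^bsub>M\<^esub> f x) x)"
      "(\<lambda>x\<in>carrier M. (c \<otimes>\<^bsub>K\<^esub> d) \<odot>\<^bsub>M\<^esub> f x) =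
        (\<lambda>x\<in>carrier M. c \<odot>\<^bsub>M\<^esub> (\<lambda>x\<in>carrier M. d \<odot>\<^bsub>M\<^esub> f x) x)"
      using * by (auto intro!: eq simp: cM M.smult_l_distr M.smult_assoc1)
  next
    fix c f g assume *: "c \<in> carrier K" "f \<in> lin_maps K M M" "g \<in> lin_maps K M M"
    then show "(\<lambda>x\<in>carrier M. c \<odot>\<^bsub>M\<^esub> (\<lambda>x\<in>carrier M. f x \<oplus>\<^bsub>M\<^esub> g x) x) =
        (\<lambda>x\<in>carrier M. (\<lambda>x\<in>carrier M. c \<odot>\<^bsub>M\<^esub> f x) x \<oplus>\<^bsub>M\<^esub> (\<lambda>x\<in>carrier M. c \<odot>\<^bsub>M\<^esub> g x) x)"
      by (auto intro!: eq simp: cM M.smult_r_distr)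
  next
    fix f assume *: "f \<in> lin_maps K M M"
    then show "(\<lambda>x\<in>carrier M. \<one>\<^bsub>K\<^esub> \<odot>\<^bsub>M\<^esub> f x) = f"
      by (auto intro!: eq simp: cM)
  qed (use cl in blast)+
  have "k_algebra_axioms K (End_alg K M)"
  proof (rule k_algebra_axioms.intro, unfold End_alg_simps)
    fix c f g assume *: "c \<in> carrier K" "f \<in> lin_maps K M M" "g \<in> lin_maps K M M"
    show "compose (carrier M) (\<lambda>x\<in>carrier M. c \<odot>\<^bsub>M\<^esub> f x) g =
        (\<lambda>x\<in>carrier M. c \<odot>\<^bsub>M\<^esub> compose (carrier M) f g x)"
      "compose (carrier M) f (\<lambda>x\<in>carrier M. c \<odot>\<^bsub>M\<^esub> g x) =
        (\<lambda>x\<in>carrier M. c \<odot>\<^bsub>M\<^esub> compose (carrier M) f g x)"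
      using * by (auto intro!: eq simp: cM compose_def smult[OF *(2)])
  qed
  then show ?thesis
    by (intro k_algebra.intro mod ring)
qed

definition conj_map :: "('k, 'a) module \<Rightarrow> ('k, 'b) module \<Rightarrow> ('a \<Rightarrow> 'b) \<Rightarrow> ('a \<Rightarrow> 'a) \<Rightarrow> 'b \<Rightarrow> 'b" where
  "conj_map M N \<Phi> f = (\<lambda>y\<in>carrier N. \<Phi> (f (inv_into (carrier M) \<Phi> y)))"

lemma inv_into_lin_maps:
  assumes "module K M" "\<Phi> \<in> lin_maps K M N" "bij_betw \<Phi> (carrier M) (carrier N)"
  shows "restrict (inv_into (carrier M) \<Phi>) (carrier N) \<in> lin_maps K N M"
proof -
  interpret M: module K M by fact
  define \<Theta> where "\<Theta> = inv_into (carrier M) \<Phi>"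
  have \<Theta>: "\<Theta> y \<in> carrier M" "\<Phi> (\<Theta> y) = y" if "y \<in> carrier N" for y
    using assms(3) that
    by (auto simp: \<Theta>_def bij_betw_def f_inv_into_f intro!: inv_into_into)
  have \<Theta>\<Phi>: "\<Theta> (\<Phi> x) = x" if "x \<in> carrier M" for x
    using assms(3) that by (simp add: \<Theta>_def bij_betw_inv_into_left)
  have N: "y \<oplus>\<^bsub>N\<^esub> z = \<Phi> (\<Theta> y \<oplus>\<^bsub>M\<^esub> \<Theta> z)" if "y \<in> carrier N" "z \<in> carrier N" for y z
    using that by (simp add: lin_mapsD[OF assms(2)] \<Theta>)
  have S: "c \<odot>\<^bsub>N\<^esub> y = \<Phi> (c \<odot>\<^bsub>M\<^esub> \<Theta> y)" if "c \<in> carrier K" "y \<in> carrier N" for c y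
    using that by (simp add: lin_mapsD[OF assms(2)] \<Theta>)
  show ?thesis
    unfolding \<Theta>_def[symmetric]
    by (intro lin_mapsI) (simp_all add: \<Theta> N S \<Theta>\<Phi> lin_mapsD(1)[OF assms(2)])
qed

lemma conj_map_alg_iso:
  assumes M: "module K M" and N: "module K N" and lin: "\<Phi> \<in> lin_maps K M N"
    and bij: "bij_betw \<Phi> (carrier M) (carrier N)"
  shows "alg_iso K (End_alg K M) (End_alg K N) (conj_map M N \<Phi>)"
proof -
  interpret M: module K M by fact
  interpret N: module K N by fact
  define \<Theta> where "\<Theta> = restrict (inv_into (carrier M) \<Phi>) (carrier N)"
  have \<Theta>\<Phi> [simp]: "\<Theta> (\<Phi> x) = x" if "x \<in> carrier M" for x
    using bij that by (auto simp: \<Theta>_def bij_betw_inv_into_left lin_mapsD(1)[OF lin])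
  have \<Phi>\<Theta> [simp]: "\<Phi> (\<Theta> y) = y" if "y \<in> carrier N" for y
    using bij that by (simp add: \<Theta>_def bij_betw_inv_into_right)
  have \<Theta>lin: "\<Theta> \<in> lin_maps K N M"
    unfolding \<Theta>_def by (rule inv_into_lin_maps; fact)
  note [simp] = lin_mapsD[OF \<Theta>lin] lin_mapsD[OF lin]
  have conj: "conj_map M N \<Phi> f = (\<lambda>y\<in>carrier N. \<Phi> (f (\<Theta> y)))" for f
    by (auto simp: conj_map_def \<Theta>_def)
  have conj': "conj_map M N \<Phi> f = compose (carrier N) \<Phi> (compose (carrier N) f \<Theta>)" for f
    by (auto simp: conj compose_def)
  show ?thesis
  proof (rule alg_iso_pullback)
    show "k_algebra K (End_alg K N)" by (rule k_algebra_End_alg; fact)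
    show "bij_betw (conj_map M N \<Phi>) (carrier (End_alg K M)) (carrier (End_alg K N))"
    proof (rule bij_betwI[where g = "\<lambda>f. compose (carrier M) \<Theta> (compose (carrier M) f \<Phi>)"])
      show "conj_map M N \<Phi> \<in> carrier (End_alg K M) \<rightarrow> carrier (End_alg K N)"
        using \<Theta>lin lin M N by (auto simp: conj' intro!: lin_maps_compose)
      show "(\<lambda>f. compose (carrier M) \<Theta> (compose (carrier M) f \<Phi>))
          \<in> carrier (End_alg K N) \<rightarrow> carrier (End_alg K M)"
        using \<Theta>lin lin M N by (auto intro!: lin_maps_compose)
      fix f assume "f \<in> carrier (End_alg K M)"
      then have f: "f \<in> lin_maps K M M" by simp
      then show "compose (carrier M) \<Theta> (compose (carrier M) (conj_map M N \<Phi> f) \<Phi>) = f"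
        using lin_mapsD(1,2)[OF f] by (auto simp: conj compose_def fun_eq_iff)
    next
      fix f assume "f \<in> carrier (End_alg K N)"
      then have f: "f \<in> lin_maps K N N" by simp
      then show "conj_map M N \<Phi> (compose (carrier M) \<Theta> (compose (carrier M) f \<Phi>)) = f"
        using lin_mapsD(1,2)[OF f] by (auto simp: conj compose_def fun_eq_iff)
    qed
    fix f assume "f \<in> carrier (End_alg K M)"
    then have f: "f \<in> lin_maps K M M" by simp
    note [simp] = lin_mapsD(1)[OF f]
    show "conj_map M N \<Phi> (c \<odot>\<^bsub>End_alg K M\<^esub> f) = c \<odot>\<^bsub>End_alg K N\<^esub> conj_map M N \<Phi> f"
      if "c \<in> carrier K" for c
      using that by (auto simp: conj intro!: restrict_ext)
    fix g assume "g \<in> carrier (End_alg K M)"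
    then have g: "g \<in> lin_maps K M M" by simp
    note [simp] = lin_mapsD(1)[OF g]
    show "conj_map M N \<Phi> (f \<otimes>\<^bsub>End_alg K M\<^esub> g) =
        conj_map M N \<Phi> f \<otimes>\<^bsub>End_alg K N\<^esub> conj_map M N \<Phi> g"
      "conj_map M N \<Phi> (f \<oplus>\<^bsub>End_alg K M\<^esub> g) =
        conj_map M N \<Phi> f \<oplus>\<^bsub>End_alg K N\<^esub> conj_map M N \<Phi> g"
      by (auto simp: conj compose_def intro!: restrict_ext)
  next
    show "conj_map M N \<Phi> \<one>\<^bsub>End_alg K M\<^esub> = \<one>\<^bsub>End_alg K N\<^esub>"
      "conj_map M N \<Phi> \<zero>\<^bsub>End_alg K M\<^esub> = \<zero>\<^bsub>End_alg K N\<^esub>"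
      using lin_maps_zero[OF lin M N] by (auto simp: conj intro!: restrict_ext)
  qed (simp_all add: End_alg_closed[OF M])
qed

section \<open>Boolean functions\<close>

lemma bool_fun_simps [simp]:
  "carrier (bool_fun x) = extensional (cube x)"
  "f \<otimes>\<^bsub>bool_fun x\<^esub> h = (\<lambda>g\<in>cube x. f g * h g)"
  "\<zero>\<^bsub>bool_fun x\<^esub> = (\<lambda>g\<in>cube x. 0)"
  "f \<oplus>\<^bsub>bool_fun x\<^esub> h = (\<lambda>g\<in>cube x. f g + h g)"
  "c \<odot>\<^bsub>bool_fun x\<^esub> f = (\<lambda>g\<in>cube x. c * f g)"
  by (simp_all add: bool_fun_def PiE_def)

lemma module_bool_fun: "module Z2 (bool_fun x)"
proof (rule moduleI)
  show "abelian_group (bool_fun x)"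
  proof (rule abelian_groupI)
    fix f assume "f \<in> carrier (bool_fun x)"
    then show "\<exists>g\<in>carrier (bool_fun x). g \<oplus>\<^bsub>bool_fun x\<^esub> f = \<zero>\<^bsub>bool_fun x\<^esub>"
      by (intro bexI[of _ f]) (simp_all only: bool_fun_simps bit_add_self)
  qed (auto intro!: extensionalityI[where A = "cube x"] simp: ac_simps)
  fix c d :: bit and f h :: "('a \<Rightarrow> bit) \<Rightarrow> bit"
  show "(c \<oplus>\<^bsub>Z2\<^esub> d) \<odot>\<^bsub>bool_fun x\<^esub> f = c \<odot>\<^bsub>bool_fun x\<^esub> f \<oplus>\<^bsub>bool_fun x\<^esub> d \<odot>\<^bsub>bool_fun x\<^esub> f"
    "c \<odot>\<^bsub>bool_fun x\<^esub> (f \<oplus>\<^bsub>bool_fun x\<^esub> h) = c \<odot>\<^bsub>bool_fun x\<^esub> f \<oplus>\<^bsub>bool_fun x\<^esub> c \<odot>\<^bsub>bool_fun x\<^esub> h"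
    by (rule extensionalityI[where A = "cube x"],
      simp_all only: bool_fun_simps Z2_simps restrict_apply' restrict_extensional semiring_class.distrib_left semiring_class.distrib_right)+
qed (auto intro!: extensionalityI[where A = "cube x"] simp: cring_Z2 ac_simps)

definition point_fun :: "'a set \<Rightarrow> ('a \<Rightarrow> bit) \<Rightarrow> ('a \<Rightarrow> bit) \<Rightarrow> bit" where
  "point_fun x h = (\<lambda>g\<in>cube x. if g = h then 1 else 0)"

lemma point_fun_closed [simp]: "point_fun x h \<in> extensional (cube x)"
  by (simp add: point_fun_def)

lemma finite_cube [simp]: "finite x \<Longrightarrow> finite (cube x)"
  using finite_UNIV_bit by (intro finite_PiE)

text \<open>The indicators of the points are a basis of the functions on a finite cube. The induction
  removes one point from the support at a time.\<close>
lemma bool_fun_lin_maps_eqI: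
  assumes x: "finite x" and N: "module Z2 N"
    and F: "F \<in> lin_maps Z2 (bool_fun x) N" and G: "G \<in> lin_maps Z2 (bool_fun x) N"
    and eq: "\<And>h. h \<in> cube x \<Longrightarrow> F (point_fun x h) = G (point_fun x h)"
  shows "F = G"
proof (rule lin_maps_eqI[OF F G])
  fix f assume "f \<in> carrier (bool_fun x)"
  then have f: "f \<in> extensional (cube x)" by simp
  have "F f = G f" if "finite H" "H \<subseteq> cube x" "f \<in> extensional (cube x)"
      "\<forall>g\<in>cube x. f g = 1 \<longrightarrow> g \<in> H" for H f
    using that
  proof (induction H arbitrary: f)
    case empty
    then have "f = \<zero>\<^bsub>bool_fun x\<^esub>" by (auto intro!: extensionalityI[where A = "cube x"])
    then show ?case
      by (simp only: lin_maps_zero[OF F module_bool_fun N] lin_maps_zero[OF G module_bool_fun N])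
  next
    case (insert h H)
    define f' where "f' = f(h := 0)"
    have h: "h \<in> cube x" using insert.prems by auto
    have f': "f' \<in> extensional (cube x)"
      unfolding f'_def extensional_def mem_Collect_eq
    proof (intro allI impI)
      fix g assume "g \<notin> cube x"
      then have "g \<noteq> h" "f g = undefined"
        using h extensional_arb[OF insert.prems(2)] by blast+
      then show "(f(h := 0)) g = undefined" by simp
    qed
    have f'h: "f' g = (if g = h then 0 else f g)" for g by (simp add: f'_def)
    have IH: "F f' = G f'"
    proof (rule insert.IH)
      show "\<forall>g\<in>cube x. f' g = 1 \<longrightarrow> g \<in> H"
        using insert.prems(3) by (auto simp: f'h)
    qed (use insert.prems f' in auto)
    have split: "f = f' \<oplus>\<^bsub>bool_fun x\<^esub> (f h \<odot>\<^bsub>bool_fun x\<^esub> point_fun x h)"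
      using insert.prems(2)
      by (intro extensionalityI[where A = "cube x"]) (auto simp: f'h point_fun_def)
    have Ff: "E f = E f' \<oplus>\<^bsub>N\<^esub> f h \<odot>\<^bsub>N\<^esub> E (point_fun x h)"
      if E: "E \<in> lin_maps Z2 (bool_fun x) N" for E
    proof -
      have "E f = E (f' \<oplus>\<^bsub>bool_fun x\<^esub> (f h \<odot>\<^bsub>bool_fun x\<^esub> point_fun x h))"
        using split by (rule arg_cong)
      also have "\<dots> = E f' \<oplus>\<^bsub>N\<^esub> E (f h \<odot>\<^bsub>bool_fun x\<^esub> point_fun x h)"
        by (rule lin_mapsD(3)[OF E]) (simp_all add: f')
      also have "E (f h \<odot>\<^bsub>bool_fun x\<^esub> point_fun x h) = f h \<odot>\<^bsub>N\<^esub> E (point_fun x h)"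
        by (rule lin_mapsD(4)[OF E]) simp_all
      finally show ?thesis .
    qed
    show ?case
      using h by (simp only: Ff[OF F] Ff[OF G] IH eq)
  qed
  from this[of "cube x" f] x f show "F f = G f" by simp
qed

section \<open>Words as operators\<close>

lemma flip_cube [simp]: "g \<in> cube x \<Longrightarrow> a \<in> x \<Longrightarrow> g(a := b) \<in> cube x"
  by (auto simp: PiE_def extensional_def)

lemma val_Co [simp]:
  "f \<in> extensional (cube x) \<Longrightarrow> g \<in> cube x \<Longrightarrow> val x (Co a) f g = g a * f g"
  by (simp add: coord_def)

lemma add_unit_vec:
  "g \<in> cube x \<Longrightarrow> a \<in> x \<Longrightarrow> (\<lambda>b\<in>x. g b + unit_vec x a b) = g(a := g a + 1)"
  by (auto simp: unit_vec_def fun_eq_iff PiE_def extensional_def)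

lemma val_Dv [simp]:
  "f \<in> extensional (cube x) \<Longrightarrow> g \<in> cube x \<Longrightarrow> a \<in> x \<Longrightarrow>
    val x (Dv a) f g = f (g(a := g a + 1)) + f g"
  by (simp only: val.simps restrict_apply' bool_fun_simps bool_deriv_def add_unit_vec)

lemma val_Wmult [simp]:
  "f \<in> extensional (cube x) \<Longrightarrow> val x (Wmult p q) f = val x p (val x q f)"
  by (simp add: compose_def)

lemma val_Wadd [simp]:
  "f \<in> extensional (cube x) \<Longrightarrow> g \<in> cube x \<Longrightarrow> val x (Wadd p q) f g = val x p f g + val x q f g"
  by (simp only: val.simps End_alg_simps bool_fun_simps restrict_apply')

lemma val_Wone [simp]: "f \<in> extensional (cube x) \<Longrightarrow> val x Wone f = f"
  by simp

lemma val_Wzero [simp]: "f \<in> extensional (cube x) \<Longrightarrow> g \<in> cube x \<Longrightarrow> val x Wzero f g = 0"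
  by simp

declare val.simps [simp del]

lemma val_closed:
  assumes "p \<in> ops x"
  shows "val x p \<in> lin_maps Z2 (bool_fun x) (bool_fun x)"
  using assms
proof (induction rule: ops.induct)
  case (1 a)
  have "val x (Co a) = (\<lambda>f\<in>extensional (cube x). \<lambda>g\<in>cube x. g a * f g)"
    by (auto simp: val.simps(1) coord_def intro!: restrict_ext)
  moreover have "(\<lambda>f\<in>extensional (cube x). \<lambda>g\<in>cube x. g a * f g)
      \<in> lin_maps Z2 (bool_fun x) (bool_fun x)"
    by (intro lin_mapsI)
      (auto simp only: bool_fun_simps Z2_simps restrict_apply restrict_extensional if_True if_False
        semiring_class.distrib_left mult.left_commute intro!: restrict_ext)
  ultimately show ?case by (simp only:)
next
  case (2 a)
  have "bool_deriv x a (f \<oplus>\<^bsub>bool_fun x\<^esub> h) = bool_deriv x a f \<oplus>\<^bsub>bool_fun x\<^esub> bool_deriv x a h" for f h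
    using 2
    by (auto simp: bool_deriv_def add_unit_vec ac_simps intro!: restrict_ext)
  moreover have "bool_deriv x a (c \<odot>\<^bsub>bool_fun x\<^esub> h) = c \<odot>\<^bsub>bool_fun x\<^esub> bool_deriv x a h" for c h
    using 2
    by (auto simp: bool_deriv_def add_unit_vec semiring_class.distrib_left intro!: restrict_ext)
  moreover have "bool_deriv x a h \<in> extensional (cube x)" for h
    by (simp add: bool_deriv_def)
  ultimately show ?case
    unfolding val.simps(2)
    by (intro lin_mapsI)
      (simp_all only: restrict_apply' bool_fun_simps restrict_extensional, simp_all)
next
  case (5 p q)
  then show ?case
    unfolding val.simps End_alg_simps by (intro End_alg_closed module_bool_fun)
next
  case (6 p q)
  then show ?case
    unfolding val.simps End_alg_simps by (intro End_alg_closed module_bool_fun)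
qed (unfold val.simps End_alg_simps, (intro End_alg_closed module_bool_fun)+)

lemma val_ext [simp]: "p \<in> ops x \<Longrightarrow> f \<in> extensional (cube x) \<Longrightarrow> val x p f \<in> extensional (cube x)"
  using lin_mapsD(1)[OF val_closed] by simp

lemma val_eqI:
  assumes "p \<in> ops x" "q \<in> ops x"
    and "\<And>f g. f \<in> extensional (cube x) \<Longrightarrow> g \<in> cube x \<Longrightarrow> val x p f g = val x q f g"
  shows "val x p = val x q"
  using assms
  by (intro lin_maps_eqI[OF val_closed val_closed] extensionalityI[where A = "cube x"]) auto

section \<open>Matrix units\<close>

text \<open>The word of the projection onto the functions supported where the coordinate of \<open>a\<close> has the
  value \<open>b\<close>.\<close>
definition point_word :: "'a \<Rightarrow> bit \<Rightarrow> 'a opword" where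
  "point_word a b = (if b = 1 then Co a else Wadd (Co a) Wone)"

text \<open>Since \<open>\<partial>\<^sub>a + 1\<close> is the shift along \<open>a\<close>, this is the word of \<open>f(g) \<mapsto> f(g + b e\<^sub>a)\<close>.\<close>
definition shift_word :: "'a \<Rightarrow> bit \<Rightarrow> 'a opword" where
  "shift_word a b = (if b = 0 then Wone else Wadd (Dv a) Wone)"

text \<open>The letters form a list because the product is noncommutative; the matrix units are obtained
  for lists without repetition that exhaust the alphabet.\<close>
primrec unit_word :: "'a list \<Rightarrow> ('a \<Rightarrow> bit) \<Rightarrow> ('a \<Rightarrow> bit) \<Rightarrow> 'a opword" where
  "unit_word [] g h = Wone"
| "unit_word (a # as) g h =
    Wmult (Wmult (point_word a (g a)) (shift_word a (g a + h a))) (unit_word as g h)"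

lemma ops_words [simp, intro]:
  "a \<in> x \<Longrightarrow> Co a \<in> ops x" "a \<in> x \<Longrightarrow> Dv a \<in> ops x" "Wzero \<in> ops x" "Wone \<in> ops x"
  "p \<in> ops x \<Longrightarrow> q \<in> ops x \<Longrightarrow> Wmult p q \<in> ops x"
  "p \<in> ops x \<Longrightarrow> q \<in> ops x \<Longrightarrow> Wadd p q \<in> ops x"
  by (auto intro: ops.intros)

lemma ops_point_shift [simp]:
  "a \<in> x \<Longrightarrow> point_word a b \<in> ops x" "a \<in> x \<Longrightarrow> shift_word a b \<in> ops x"
  by (auto simp: point_word_def shift_word_def)

lemma ops_unit_word [simp]: "set as \<subseteq> x \<Longrightarrow> unit_word as g h \<in> ops x"
  by (induction as) auto

lemma val_point_word:
  "f \<in> extensional (cube x) \<Longrightarrow> g \<in> cube x \<Longrightarrow>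
    val x (point_word a b) f g = (if g a = b then f g else 0)"
  by (cases b; cases "g a") (auto simp: point_word_def)

lemma val_shift_word:
  "f \<in> extensional (cube x) \<Longrightarrow> g \<in> cube x \<Longrightarrow> a \<in> x \<Longrightarrow>
    val x (shift_word a b) f g = f (g(a := g a + b))"
  by (cases b) (simp_all add: shift_word_def add.assoc)

lemma val_unit_word:
  assumes "distinct as" "set as \<subseteq> x" "f \<in> extensional (cube x)" "g \<in> cube x"
  shows "val x (unit_word as u v) f g =
    (if \<forall>a\<in>set as. g a = u a then f (\<lambda>a. if a \<in> set as then v a else g a) else 0)"
  using assms
proof (induction as arbitrary: g)
  case (Cons a as)
  have a: "a \<in> x" "a \<notin> set as" using Cons.prems by auto
  have 1: "g a + (g a + v a) = v a" by (rule bit_add_self_left)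
  have 2: "(\<lambda>b. if b \<in> set as then v b else (g(a := v a)) b)
      = (\<lambda>b. if b \<in> set (a # as) then v b else g b)"
    by auto
  have 3: "(\<forall>b\<in>set as. (g(a := v a)) b = u b) \<longleftrightarrow> (\<forall>b\<in>set as. g b = u b)"
    using a by auto
  have "val x (unit_word (a # as) u v) f g =
      (if g a = u a then val x (unit_word as u v) f (g(a := g a + (u a + v a))) else 0)"
    using Cons.prems a by (simp add: val_point_word val_shift_word)
  also have "\<dots> = (if g a = u a then val x (unit_word as u v) f (g(a := v a)) else 0)"
    by (simp add: 1)
  also have "\<dots> = (if g a = u a then
      (if \<forall>b\<in>set as. g b = u b then f (\<lambda>b. if b \<in> set (a # as) then v b else g b) else 0) else 0)"
    using Cons.prems a by (subst Cons.IH) (auto simp only: 2 3 flip_cube distinct.simps set_simps)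
  finally show ?case by auto
qed auto

lemma val_unit_word_full:
  assumes "distinct as" "set as = x" "f \<in> extensional (cube x)" "g \<in> cube x" "u \<in> cube x" "v \<in> cube x"
  shows "val x (unit_word as u v) f g = (if g = u then f v else 0)"
proof -
  have "(\<forall>a\<in>x. g a = u a) \<longleftrightarrow> g = u"
    using assms(4,5) by (auto simp: PiE_def intro: extensionalityI)
  moreover have "(\<lambda>a. if a \<in> x then v a else g a) = v"
    using assms(4,6) by (auto simp: fun_eq_iff PiE_def extensional_def)
  ultimately show ?thesis using assms by (simp add: val_unit_word)
qed

text \<open>The words of matrix units can be added up with any \<open>0\<close>-\<open>1\<close> matrix as coefficients; the entries
  needed for \<open>F\<close> are read off from its values at the indicators of points.\<close>
lemma val_surj:
  assumes x: "finite x" and F: "F \<in> lin_maps Z2 (bool_fun x) (bool_fun x)"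
  shows "\<exists>w\<in>ops x. val x w = F"
proof -
  obtain as where as: "distinct as" "set as = x" using finite_distinct_list[OF x] by blast
  have *: "\<exists>w\<in>ops x. \<forall>f\<in>extensional (cube x). \<forall>g\<in>cube x.
      val x w f g = (\<Sum>h | h \<in> cube x \<and> (g, h) \<in> S. f h)"
    if "finite S" "S \<subseteq> cube x \<times> cube x" for S
    using that
  proof (induction S)
    case empty
    then show ?case by (intro bexI[of _ Wzero]) auto
  next
    case (insert p S)
    obtain u v where p: "p = (u, v)" by (cases p)
    from insert obtain w where w: "w \<in> ops x"
      "\<And>f g. f \<in> extensional (cube x) \<Longrightarrow> g \<in> cube x \<Longrightarrow>
        val x w f g = (\<Sum>h | h \<in> cube x \<and> (g, h) \<in> S. f h)" by auto
    have uv: "u \<in> cube x" "v \<in> cube x" using insert.prems p by auto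
    show ?case
    proof (intro bexI ballI)
      show "Wadd (unit_word as u v) w \<in> ops x" using w as by auto
      fix f :: "('a \<Rightarrow> bit) \<Rightarrow> bit" and g
      assume fg: "f \<in> extensional (cube x)" "g \<in> cube x"
      have "{h. h \<in> cube x \<and> (g, h) \<in> insert p S} =
        (if g = u then insert v {h. h \<in> cube x \<and> (g, h) \<in> S} else {h. h \<in> cube x \<and> (g, h) \<in> S})"
        using uv p by auto
      moreover have "v \<notin> {h. h \<in> cube x \<and> (u, h) \<in> S}" using insert.hyps p by auto
      ultimately show "val x (Wadd (unit_word as u v) w) f g
          = (\<Sum>h | h \<in> cube x \<and> (g, h) \<in> insert p S. f h)"
        using fg uv w as x by (simp add: val_unit_word_full)
    qed
  qed
  \<comment> \<open>The matrix of \<open>F\<close>.\<close>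
  define S where "S = {(g, h). g \<in> cube x \<and> h \<in> cube x \<and> F (point_fun x h) g = 1}"
  have S: "S \<subseteq> cube x \<times> cube x" by (auto simp: S_def)
  then have "finite S" by (rule finite_subset) (use x in auto)
  from *[OF this S] obtain w where w: "w \<in> ops x"
    "\<And>f g. f \<in> extensional (cube x) \<Longrightarrow> g \<in> cube x \<Longrightarrow>
      val x w f g = (\<Sum>h | h \<in> cube x \<and> (g, h) \<in> S. f h)" by auto
  have "val x w = F"
  proof (rule bool_fun_lin_maps_eqI[OF x module_bool_fun val_closed[OF w(1)] F])
    fix h assume h: "h \<in> cube x"
    show "val x w (point_fun x h) = F (point_fun x h)"
    proof (rule extensionalityI[where A = "cube x"])
      fix g assume g: "g \<in> cube x"
      have fin: "finite {k. k \<in> cube x \<and> (g, k) \<in> S}" using x by simp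
      have "val x w (point_fun x h) g = (\<Sum>k | k \<in> cube x \<and> (g, k) \<in> S. point_fun x h k)"
        using w(2)[OF _ g] by simp
      also have "\<dots> = (\<Sum>k | k \<in> cube x \<and> (g, k) \<in> S. if k = h then 1 else 0)"
        by (intro sum.cong) (auto simp: point_fun_def)
      also have "\<dots> = (if (g, h) \<in> S then 1 else 0)"
        using h fin by (simp add: sum.delta)
      also have "\<dots> = F (point_fun x h) g"
        using g h by (cases "F (point_fun x h) g") (auto simp: S_def)
      finally show "val x w (point_fun x h) g = F (point_fun x h) g" .
    qed (use w lin_mapsD(1)[OF F] in auto)
  qed
  with w(1) show ?thesis by blast
qed

section \<open>Rings generated by a Boole-Weyl family\<close>

text \<open>The defining relations in an arbitrary ring of characteristic two. The matrix units are
  studied at this level because the algebra given by generators and relations is not yet known to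
  be an algebra of operators.\<close>
locale boole_weyl_family = ring A for A (structure) +
  fixes I :: "'i set" and \<xi> \<eta> :: "'i \<Rightarrow> 'a"
  assumes x_closed [simp]: "i \<in> I \<Longrightarrow> \<xi> i \<in> carrier A"
    and y_closed [simp]: "i \<in> I \<Longrightarrow> \<eta> i \<in> carrier A"
    and add_self [simp]: "r \<in> carrier A \<Longrightarrow> r \<oplus> r = \<zero>"
    and x_idem: "i \<in> I \<Longrightarrow> \<xi> i \<otimes> \<xi> i = \<xi> i"
    and y_nil: "i \<in> I \<Longrightarrow> \<eta> i \<otimes> \<eta> i = \<zero>"
    and y_x: "i \<in> I \<Longrightarrow> \<eta> i \<otimes> \<xi> i = \<xi> i \<otimes> \<eta> i \<oplus> \<eta> i \<oplus> \<one>"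
    and x_x_comm: "i \<in> I \<Longrightarrow> j \<in> I \<Longrightarrow> \<xi> i \<otimes> \<xi> j = \<xi> j \<otimes> \<xi> i"
    and y_y_comm: "i \<in> I \<Longrightarrow> j \<in> I \<Longrightarrow> \<eta> i \<otimes> \<eta> j = \<eta> j \<otimes> \<eta> i"
    and y_x_comm: "i \<in> I \<Longrightarrow> j \<in> I \<Longrightarrow> i \<noteq> j \<Longrightarrow> \<eta> i \<otimes> \<xi> j = \<xi> j \<otimes> \<eta> i"
begin

primrec eval_word :: "'i opword \<Rightarrow> 'a" where
  "eval_word (Co i) = \<xi> i"
| "eval_word (Dv i) = \<eta> i"
| "eval_word Wzero = \<zero>"
| "eval_word Wone = \<one>"
| "eval_word (Wmult p q) = eval_word p \<otimes> eval_word q"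
| "eval_word (Wadd p q) = eval_word p \<oplus> eval_word q"

lemma eval_word_closed [simp]: "p \<in> ops I \<Longrightarrow> eval_word p \<in> carrier A"
  by (induction rule: ops.induct) auto

abbreviation P where "P i b \<equiv> eval_word (point_word i b)"
abbreviation S where "S i b \<equiv> eval_word (shift_word i b)"
abbreviation U where "U as g h \<equiv> eval_word (unit_word as g h)"

lemma add_self_left: "r \<in> carrier A \<Longrightarrow> s \<in> carrier A \<Longrightarrow> r \<oplus> (r \<oplus> s) = s"
  by (simp flip: a_assoc)

lemma X_point: "i \<in> I \<Longrightarrow> \<xi> i \<otimes> P i b = (if b = 1 then P i b else \<zero>)"
  by (auto simp: point_word_def r_distr x_idem)

lemma point_add: "i \<in> I \<Longrightarrow> P i 0 \<oplus> P i 1 = \<one>"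
  by (simp add: point_word_def a_ac add_self_left)

lemma S_X: "i \<in> I \<Longrightarrow> S i 1 \<otimes> \<xi> i = (\<xi> i \<oplus> \<one>) \<otimes> S i 1"
  by (simp add: shift_word_def l_distr r_distr y_x a_ac)

lemma S_point: "i \<in> I \<Longrightarrow> S i 1 \<otimes> P i b = P i (b + 1) \<otimes> S i 1"
proof (cases "b = 0")
  case True
  assume i: "i \<in> I"
  then have "S i 1 \<otimes> (\<xi> i \<oplus> \<one>) = (\<xi> i \<oplus> \<one>) \<otimes> S i 1 \<oplus> S i 1"
    by (simp add: r_distr S_X)
  also have "\<dots> = \<xi> i \<otimes> S i 1"
    using i by (simp add: l_distr a_assoc)
  finally show ?thesis using True by (simp add: point_word_def)
qed (simp add: point_word_def S_X)

lemma S_S: "i \<in> I \<Longrightarrow> S i b \<otimes> S i c = S i (b + c)"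
  by (cases b; cases c) (simp_all add: shift_word_def l_distr r_distr y_nil a_assoc add_self_left)

lemma commute_point_shift:
  assumes "j \<in> I" "z \<in> carrier A" "z \<otimes> \<xi> j = \<xi> j \<otimes> z" "z \<otimes> \<eta> j = \<eta> j \<otimes> z"
  shows "z \<otimes> (P j b \<otimes> S j c) = (P j b \<otimes> S j c) \<otimes> z"
proof -
  have P: "z \<otimes> P j b = P j b \<otimes> z" and S: "z \<otimes> S j c = S j c \<otimes> z"
    using assms by (auto simp: point_word_def shift_word_def l_distr r_distr)
  have "z \<otimes> (P j b \<otimes> S j c) = P j b \<otimes> z \<otimes> S j c"
    using assms by (simp add: P flip: m_assoc)
  also have "\<dots> = (P j b \<otimes> S j c) \<otimes> z"
    using assms by (simp add: S m_assoc)
  finally show ?thesis .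
qed

lemma commute_off_diag:
  assumes "i \<in> I" "j \<in> I" "i \<noteq> j"
  shows "\<xi> i \<otimes> (P j b \<otimes> S j c) = (P j b \<otimes> S j c) \<otimes> \<xi> i"
    "S i 1 \<otimes> (P j b \<otimes> S j c) = (P j b \<otimes> S j c) \<otimes> S i 1"
proof -
  show "\<xi> i \<otimes> (P j b \<otimes> S j c) = (P j b \<otimes> S j c) \<otimes> \<xi> i"
    using assms by (intro commute_point_shift) (simp_all add: x_x_comm y_x_comm)
  show "S i 1 \<otimes> (P j b \<otimes> S j c) = (P j b \<otimes> S j c) \<otimes> S i 1"
    using assms
    by (intro commute_point_shift)
      (simp_all add: shift_word_def l_distr r_distr y_y_comm[of i j] y_x_comm)
qed

lemma U_cong:
  "(\<And>a. a \<in> set as \<Longrightarrow> g a = g' a) \<Longrightarrow> (\<And>a. a \<in> set as \<Longrightarrow> h a = h' a) \<Longrightarrow>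
    U as g h = U as g' h'"
  by (induction as) auto

text \<open>The next two lemmas are the multiplication table: a coordinate keeps or annihilates a matrix
  unit according to its row, and a shift moves the row. Each generator passes the factors of the
  other letters and acts on the factor of its own letter.\<close>
lemma x_times_unit:
  assumes "distinct as" "set as \<subseteq> I" "i \<in> set as"
  shows "\<xi> i \<otimes> U as g h = (if g i = 1 then U as g h else \<zero>)"
  using assms
proof (induction as)
  case (Cons j as)
  have j: "j \<in> I" "i \<in> I" using Cons.prems by auto
  show ?case
  proof (cases "i = j")
    case True
    have "\<xi> j \<otimes> U (j # as) g h = (\<xi> j \<otimes> P j (g j)) \<otimes> S j (g j + h j) \<otimes> U as g h"
      using j Cons.prems by (simp add: m_assoc)
    then show ?thesis using True j Cons.prems by (simp add: X_point)
  next
    case False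
    have "\<xi> i \<otimes> U (j # as) g h = (\<xi> i \<otimes> (P j (g j) \<otimes> S j (g j + h j))) \<otimes> U as g h"
      using j Cons.prems by (simp add: m_assoc)
    also have "\<dots> = (P j (g j) \<otimes> S j (g j + h j)) \<otimes> (\<xi> i \<otimes> U as g h)"
      using j False Cons.prems by (simp add: commute_off_diag) (simp add: m_assoc)
    finally show ?thesis using j False Cons by (simp add: m_assoc)
  qed
qed simp

lemma shift_times_unit:
  assumes "distinct as" "set as \<subseteq> I" "i \<in> set as"
  shows "S i 1 \<otimes> U as g h = U as (g(i := g i + 1)) h"
  using assms
proof (induction as)
  case (Cons j as)
  have j: "j \<in> I" "i \<in> I" using Cons.prems by auto
  show ?case
  proof (cases "i = j")
    case True
    have "S j 1 \<otimes> U (j # as) g h = (S j 1 \<otimes> P j (g j)) \<otimes> S j (g j + h j) \<otimes> U as g h"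
      using j Cons.prems by (simp add: m_assoc)
    also have "\<dots> = P j (g j + 1) \<otimes> (S j 1 \<otimes> S j (g j + h j)) \<otimes> U as g h"
      using j Cons.prems by (simp only: S_point) (simp add: m_assoc)
    also have "\<dots> = P j (g j + 1) \<otimes> S j ((g j + 1) + h j) \<otimes> U as g h"
      using j by (simp only: S_S ac_simps)
    also have "U as g h = U as (g(j := g j + 1)) h"
      using Cons.prems True by (intro U_cong) auto
    finally show ?thesis using True by (simp del: fun_upd_apply add: fun_upd_same)
  next
    case False
    have "S i 1 \<otimes> U (j # as) g h = (S i 1 \<otimes> (P j (g j) \<otimes> S j (g j + h j))) \<otimes> U as g h"
      using j Cons.prems by (simp add: m_assoc)
    also have "\<dots> = (P j (g j) \<otimes> S j (g j + h j)) \<otimes> (S i 1 \<otimes> U as g h)"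
      using j Cons.prems
      by (simp only: commute_off_diag(2)[OF j(2,1) False]) (simp add: m_assoc)
    finally show ?thesis using j False Cons by simp
  qed
qed simp

text \<open>This expresses that the diagonal matrix units add up to one. The letters are dealt with one at
  a time, using that the two projections of a letter add up to one, so the sum over the cube need
  not be formed.\<close>
lemma zero_if_annihilates_diagonal:
  assumes "distinct as" "set as \<subseteq> I" "r \<in> carrier A" "\<And>g. r \<otimes> U as g g = \<zero>"
  shows "r = \<zero>"
  using assms
proof (induction as arbitrary: r)
  case Nil
  then show ?case by simp
next
  case (Cons j as)
  have j: "j \<in> I" using Cons.prems by auto
  have "r \<otimes> P j b = \<zero>" for b
  proof (rule Cons.IH)
    fix g
    have "r \<otimes> P j b \<otimes> U as g g = r \<otimes> U (j # as) (g(j := b)) (g(j := b))"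
    proof -
      have "U as (g(j := b)) (g(j := b)) = U as g g"
        using Cons.prems(1) by (intro U_cong) auto
      moreover have "S j 0 = \<one>" by (simp add: shift_word_def)
      ultimately show ?thesis using j Cons.prems by (simp add: m_assoc)
    qed
    then show "r \<otimes> P j b \<otimes> U as g g = \<zero>" by (simp only: Cons.prems(4))
  qed (use Cons.prems j in auto)
  then have "r \<otimes> (P j 0 \<oplus> P j 1) = \<zero>"
    using Cons.prems j by (simp add: r_distr)
  then show ?case using j Cons.prems by (simp add: point_add)
qed

text \<open>The element \<open>\<Sum>\<^sub>g f(g) E\<^sub>g\<^sub>h\<close>: the functions on the cube, embedded as one column of the
  matrices. The condition \<open>f g = 1\<close> replaces a scalar multiplication, which a ring does not have.\<close>
definition column :: "'i list \<Rightarrow> ('i \<Rightarrow> bit) \<Rightarrow> (('i \<Rightarrow> bit) \<Rightarrow> bit) \<Rightarrow> 'a" where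
  "column as h f = (\<Oplus>g\<in>cube I. if f g = 1 then U as g h else \<zero>)"

text \<open>Left multiplication on a column is the action of the operator on functions. It is enough to
  see this for the letters, where it is the multiplication table; a shift needs in addition that
  flipping one coordinate permutes the cube.\<close>
lemma eval_word_column:
  assumes I: "finite I" and as: "distinct as" "set as = I"
    and "p \<in> ops I" "f \<in> extensional (cube I)"
  shows "eval_word p \<otimes> column as h f = column as h (val I p f)"
  using assms(4,5)
proof (induction arbitrary: f rule: ops.induct)
  note fin = finite_cube[OF I]
  have U [simp]: "U as g h \<in> carrier A" for g h using as by simp
  have cl [simp]: "(\<lambda>g. if f g = 1 then U as g h else \<zero>) \<in> S \<rightarrow> carrier A"
    for f :: "('i \<Rightarrow> bit) \<Rightarrow> bit" and S by auto
  have col [simp]: "column as h f \<in> carrier A" for f by (auto simp: column_def intro!: finsum_closed)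
  have add: "column as h f \<oplus> column as h f' = column as h f''"
    if "\<And>g. g \<in> cube I \<Longrightarrow> f'' g = f g + f' g" for f f' f''
  proof -
    have "column as h f \<oplus> column as h f' = (\<Oplus>g\<in>cube I. (if f g = 1 then U as g h else \<zero>) \<oplus> (if f' g = 1 then U as g h else \<zero>))"
      unfolding column_def by (rule finsum_addf [symmetric]) auto
    also have "\<dots> = column as h f''"
      unfolding column_def
    proof (rule finsum_cong')
      fix g assume "g \<in> cube I"
      then show "(if f g = 1 then U as g h else \<zero>) \<oplus> (if f' g = 1 then U as g h else \<zero>) =
          (if f'' g = 1 then U as g h else \<zero>)"
        by (cases "f g"; cases "f' g") (simp_all add: that)
    qed auto
    finally show ?thesis .
  qed
  {
    case (1 a)
    have "\<xi> a \<otimes> column as h f = (\<Oplus>g\<in>cube I. \<xi> a \<otimes> (if f g = 1 then U as g h else \<zero>))"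
      unfolding column_def using 1 fin by (intro finsum_rdistr) auto
    also have "\<dots> = column as h (val I (Co a) f)"
      unfolding column_def using 1 as
      by (intro finsum_cong') (auto simp: x_times_unit mult_bit_eq_and)
    finally show ?case by simp
  next
    case (2 a)
    \<comment> \<open>The flip of the coordinate \<open>a\<close>, an involution of the cube.\<close>
    define \<tau> where "\<tau> g = g(a := g a + 1)" for g :: "'i \<Rightarrow> bit"
    have \<tau>\<tau>: "\<tau> (\<tau> g) = g" for g by (simp add: \<tau>_def add.assoc)
    have \<tau>: "\<tau> g \<in> cube I" if "g \<in> cube I" for g using that 2 unfolding \<tau>_def by (intro flip_cube)
    have img: "\<tau> ` cube I = cube I"
    proof (intro equalityI subsetI)
      fix g assume "g \<in> cube I"
      then have "\<tau> (\<tau> g) \<in> \<tau> ` cube I" by (intro imageI \<tau>)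
      then show "g \<in> \<tau> ` cube I" by (simp only: \<tau>\<tau>)
    qed (use \<tau> in auto)
    have inj: "inj_on \<tau> (cube I)" by (metis \<tau>\<tau> inj_onI)
    have "S a 1 \<otimes> column as h f = (\<Oplus>g\<in>cube I. S a 1 \<otimes> (if f g = 1 then U as g h else \<zero>))"
      unfolding column_def using 2 fin by (intro finsum_rdistr) auto
    also have "\<dots> = (\<Oplus>g\<in>cube I. if f (\<tau> (\<tau> g)) = 1 then U as (\<tau> g) h else \<zero>)"
      using 2 as by (intro finsum_cong') (auto simp: shift_times_unit \<tau>\<tau>, simp add: \<tau>_def)
    also have "\<dots> = (\<Oplus>g\<in>\<tau> ` cube I. if f (\<tau> g) = 1 then U as g h else \<zero>)"
      using inj by (subst finsum_reindex) auto
    finally have S: "S a 1 \<otimes> column as h f = column as h (\<lambda>g. f (\<tau> g))"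
      by (simp add: img column_def)
    have "\<eta> a = S a 1 \<oplus> \<one>" using 2 by (simp add: shift_word_def a_assoc)
    then have "\<eta> a \<otimes> column as h f = S a 1 \<otimes> column as h f \<oplus> column as h f"
      using 2 by (simp add: l_distr)
    also have "\<dots> = column as h (val I (Dv a) f)"
      unfolding S using 2 by (intro add) (simp add: \<tau>_def)
    finally show ?case by simp
  next
    case 3
    have "column as h (val I Wzero f) = (\<Oplus>g\<in>cube I. \<zero>)"
      unfolding column_def using 3 by (intro finsum_cong') auto
    then show ?case by simp
  next
    case 4
    then show ?case by simp
  next
    case (5 p q)
    then show ?case by (simp add: m_assoc)
  next
    case (6 p q)
    then have "eval_word (Wadd p q) \<otimes> column as h f = column as h (val I p f) \<oplus> column as h (val I q f)"
      by (simp add: l_distr)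
    also have "\<dots> = column as h (val I (Wadd p q) f)"
      using 6 by (intro add) simp
    finally show ?case .
  }
qed

lemma column_point_fun:
  assumes "finite I" "set as = I" "h \<in> cube I"
  shows "column as h (point_fun I h) = U as h h"
proof -
  have "column as h (point_fun I h) = (\<Oplus>g\<in>cube I. if h = g then U as g h else \<zero>)"
    unfolding column_def using assms by (intro finsum_cong') (auto simp: point_fun_def)
  also have "\<dots> = U as h h"
    using assms by (intro finsum_singleton) auto
  finally show ?thesis .
qed

text \<open>The diagonal matrix unit at \<open>h\<close> is the column of the indicator of \<open>h\<close>, so a word with the
  operator zero annihilates it.\<close>
lemma eval_word_eq_zero:
  assumes I: "finite I" and p: "p \<in> ops I" and 0: "val I p = val I Wzero"
  shows "eval_word p = \<zero>"
proof -
  obtain as where as: "distinct as" "set as = I" using finite_distinct_list[OF I] by blast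
  have *: "eval_word p \<otimes> U as h h = \<zero>" if h: "h \<in> cube I" for h
  proof -
    have "eval_word p \<otimes> U as h h = column as h (val I p (point_fun I h))"
      using h I as p by (simp add: column_point_fun flip: eval_word_column)
    also have "\<dots> = (\<Oplus>g\<in>cube I. \<zero>)"
      unfolding column_def 0 by (intro finsum_cong') auto
    finally show ?thesis by simp
  qed
  have all: "eval_word p \<otimes> U as g g = \<zero>" for g
  proof -
    have "U as g g = U as (restrict g I) (restrict g I)"
      using as(2) by (intro U_cong) auto
    moreover have "eval_word p \<otimes> U as (restrict g I) (restrict g I) = \<zero>"
      by (rule *) simp
    ultimately show ?thesis by (simp only:)
  qed
  show ?thesis
    by (rule zero_if_annihilates_diagonal[OF as(1) _ eval_word_closed[OF p] all]) (simp only: as(2) order_refl)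
qed

theorem eval_word_cong:
  assumes I: "finite I" and pq: "p \<in> ops I" "q \<in> ops I" and eq: "val I p = val I q"
  shows "eval_word p = eval_word q"
proof -
  have "val I (Wadd p q) = val I Wzero"
    using pq eq by (intro val_eqI) auto
  then have "eval_word (Wadd p q) = \<zero>"
    using I pq by (intro eval_word_eq_zero) auto
  then have "(eval_word p \<oplus> eval_word q) \<oplus> eval_word q = eval_word q"
    using pq by simp
  moreover have "(eval_word p \<oplus> eval_word q) \<oplus> eval_word q = eval_word p"
    using pq by (simp only: a_assoc eval_word_closed add_self r_zero)
  ultimately show ?thesis by simp
qed

end

section \<open>Words equal in the presentation are equal as operators\<close>

lemma bw_rel_ops: "(p, q) \<in> bw_rel x \<Longrightarrow> p \<in> ops x \<and> q \<in> ops x"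
  by (induction rule: bw_rel.induct) auto

lemma bw_rel_sound:
  assumes "(p, q) \<in> bw_rel x"
  shows "val x p = val x q"
  using assms
proof (induction rule: bw_rel.induct)
  case (y_x i)
  show ?case
  proof (intro val_eqI)
    fix f :: "('a \<Rightarrow> bit) \<Rightarrow> bit" and g assume "f \<in> extensional (cube x)" "g \<in> cube x"
    then show "val x (Wmult (Dv i) (Co i)) f g = val x (Wadd (Wadd (Wmult (Co i) (Dv i)) (Dv i)) Wone) f g"
      using y_x by (cases "g i"; cases "f g"; cases "f (g(i := g i + 1))") simp_all
  qed (use y_x in auto)
next
  case (y_y_comm i j)
  show ?case
  proof (intro val_eqI)
    fix f :: "('a \<Rightarrow> bit) \<Rightarrow> bit" and g assume "f \<in> extensional (cube x)" "g \<in> cube x"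
    then show "val x (Wmult (Dv i) (Dv j)) f g = val x (Wmult (Dv j) (Dv i)) f g"
      using y_y_comm by (cases "i = j") (simp_all add: fun_upd_twist ac_simps)
  qed (use y_y_comm in auto)
next
  case (y_x_comm i j)
  show ?case
    using y_x_comm by (intro val_eqI) (auto simp: semiring_class.distrib_left)
next
  case (cong_add p p' q q')
  then show ?case by (simp add: val.simps)
next
  case (cong_mult p p' q q')
  then show ?case by (simp add: val.simps)
next
  case (distrib_left p q r)
  then show ?case
    using lin_mapsD(3)[OF val_closed[of p x]]
    by (intro val_eqI)
      (auto simp flip: bool_fun_simps(4) simp: val.simps(6) compose_def)
next
  case (sym p q)
  then show ?case by simp
next
  case (trans p q r)
  then show ?case by simp
next
  case (y_nil i)
  then show ?case
    by (intro val_eqI) (auto simp: ac_simps)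
qed (auto intro!: val_eqI simp: ac_simps)

section \<open>The Boole-Weyl algebra as the algebra of operators\<close>

definition bw_class :: "'a set \<Rightarrow> 'a opword \<Rightarrow> 'a opword set" where
  "bw_class x p = bw_rel x `` {p}"

abbreviation bw_quot :: "'a set \<Rightarrow> (bit, 'a opword set) module" where
  "bw_quot x \<equiv> word_quot x (bw_rel x)"

lemma equiv_bw_rel: "equiv (ops x) (bw_rel x)"
  by (intro equivI)
    (auto simp: refl_on_def sym_def trans_def dest: bw_rel_ops intro: bw_rel.refl bw_rel.sym bw_rel.trans)

lemma bw_class_eq_iff:
  "p \<in> ops x \<Longrightarrow> q \<in> ops x \<Longrightarrow> bw_class x p = bw_class x q \<longleftrightarrow> (p, q) \<in> bw_rel x"
  unfolding bw_class_def by (rule eq_equiv_class_iff[OF equiv_bw_rel])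

lemma bw_class_eqI: "(p, q) \<in> bw_rel x \<Longrightarrow> bw_class x p = bw_class x q"
  unfolding bw_class_def by (rule equiv_class_eq[OF equiv_bw_rel])

lemma carrier_bw_quot: "carrier (bw_quot x) = bw_class x ` ops x"
  by (auto simp: word_quot_def quotient_def bw_class_def)

lemma bw_class_closed [simp]: "p \<in> ops x \<Longrightarrow> bw_class x p \<in> carrier (bw_quot x)"
  by (simp add: carrier_bw_quot)

lemma bw_quot_ops:
  "p \<in> ops x \<Longrightarrow> q \<in> ops x \<Longrightarrow> bw_class x p \<otimes>\<^bsub>bw_quot x\<^esub> bw_class x q = bw_class x (Wmult p q)"
  "p \<in> ops x \<Longrightarrow> q \<in> ops x \<Longrightarrow> bw_class x p \<oplus>\<^bsub>bw_quot x\<^esub> bw_class x q = bw_class x (Wadd p q)"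
  "\<one>\<^bsub>bw_quot x\<^esub> = bw_class x Wone"
  "\<zero>\<^bsub>bw_quot x\<^esub> = bw_class x Wzero"
  "c \<odot>\<^bsub>bw_quot x\<^esub> P = (if c = 0 then bw_class x Wzero else P)"
proof -
  note eq = bw_class_eqI[unfolded bw_class_def]
  assume pq: "p \<in> ops x" "q \<in> ops x"
  show "bw_class x p \<otimes>\<^bsub>bw_quot x\<^esub> bw_class x q = bw_class x (Wmult p q)"
    unfolding word_quot_def monoid.simps bw_class_def
    using pq
    by (intro UN_equiv_class2[OF equiv_bw_rel equiv_bw_rel] congruent2I' eq bw_rel.cong_mult)
  show "bw_class x p \<oplus>\<^bsub>bw_quot x\<^esub> bw_class x q = bw_class x (Wadd p q)"
    unfolding word_quot_def ring.simps bw_class_def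
    using pq
    by (intro UN_equiv_class2[OF equiv_bw_rel equiv_bw_rel] congruent2I' eq bw_rel.cong_add)
qed (simp_all add: word_quot_def bw_class_def)

lemma ring_bw_quot: "ring (bw_quot x)"
proof (rule ringI)
  note [simp] = bw_quot_ops(1-4) and [intro!] = bw_class_eqI and [rule del] = equalityI
  show "abelian_group (bw_quot x)"
  proof (rule abelian_groupI)
    fix P assume "P \<in> carrier (bw_quot x)"
    then obtain p where "P = bw_class x p" "p \<in> ops x" by (auto simp: carrier_bw_quot)
    then show "\<exists>Q\<in>carrier (bw_quot x). Q \<oplus>\<^bsub>bw_quot x\<^esub> P = \<zero>\<^bsub>bw_quot x\<^esub>"
      by (intro bexI[of _ P]) (auto intro: bw_rel.add_self)
  qed (auto simp: carrier_bw_quot intro: bw_rel.add_assoc bw_rel.add_comm bw_rel.add_zero)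
  show "Group.monoid (bw_quot x)"
    by (rule monoidI)
      (auto simp: carrier_bw_quot intro: bw_rel.mult_assoc bw_rel.mult_one_left bw_rel.mult_one_right)
qed (auto simp: carrier_bw_quot bw_quot_ops del: equalityI intro!: bw_class_eqI intro: bw_rel.distrib_left bw_rel.distrib_right)

lemma boole_weyl_family_bw_quot:
  "boole_weyl_family (bw_quot x) x (\<lambda>i. bw_class x (Co i)) (\<lambda>i. bw_class x (Dv i))"
  by (intro boole_weyl_family.intro boole_weyl_family_axioms.intro ring_bw_quot)
    (auto simp: carrier_bw_quot bw_quot_ops
      del: equalityI intro!: bw_class_eqI intro: bw_rel.add_self bw_rel.x_idem bw_rel.y_nil bw_rel.y_x bw_rel.x_x_comm
        bw_rel.y_y_comm bw_rel.y_x_comm)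

text \<open>Evaluation in the quotient by the presentation is passage to the class, so the result on
  arbitrary Boole-Weyl families says that equal operators have equal classes.\<close>
lemma bw_rel_complete:
  assumes x: "finite x" and pq: "p \<in> ops x" "q \<in> ops x" and eq: "val x p = val x q"
  shows "(p, q) \<in> bw_rel x"
proof -
  interpret boole_weyl_family "bw_quot x" x "\<lambda>i. bw_class x (Co i)" "\<lambda>i. bw_class x (Dv i)"
    by (rule boole_weyl_family_bw_quot)
  have "eval_word p = bw_class x p" if "p \<in> ops x" for p
    using that by (induction rule: ops.induct) (simp_all add: bw_quot_ops)
  then show ?thesis
    using eval_word_cong[OF x pq eq] pq by (simp add: bw_class_eq_iff)
qed

lemma op_rel_eq_bw_rel: "finite x \<Longrightarrow> op_rel x = bw_rel x"
  by (auto simp: op_rel_def bw_rel_complete dest: bw_rel_ops bw_rel_sound)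

lemma OR_eq_bw_quot: "finite x \<Longrightarrow> OR x = bw_quot x"
  by (simp add: OR_def op_rel_eq_bw_rel)

text \<open>All words of a class have the same operator, hence the image is a singleton.\<close>
definition class_val :: "'a set \<Rightarrow> 'a opword set \<Rightarrow> (('a \<Rightarrow> bit) \<Rightarrow> bit) \<Rightarrow> ('a \<Rightarrow> bit) \<Rightarrow> bit" where
  "class_val x P = the_elem (val x ` P)"

lemma class_val_bw_class:
  assumes "p \<in> ops x"
  shows "class_val x (bw_class x p) = val x p"
proof -
  have "val x ` bw_class x p = {val x p}"
    using assms by (auto simp: bw_class_def image_iff dest: bw_rel_sound intro: bw_rel.refl)
  then show ?thesis by (simp add: class_val_def)
qed

theorem OR_iso_End_bool_fun:
  assumes x: "finite x"
  shows "alg_iso Z2 (OR x) (End_alg Z2 (bool_fun x)) (class_val x)"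
  unfolding OR_eq_bw_quot[OF x]
proof (rule alg_iso_pullback)
  show "k_algebra Z2 (End_alg Z2 (bool_fun x))"
    by (rule k_algebra_End_alg[OF module_bool_fun])
  show "bij_betw (class_val x) (carrier (bw_quot x)) (carrier (End_alg Z2 (bool_fun x)))"
  proof (rule bij_betw_imageI)
    show "inj_on (class_val x) (carrier (bw_quot x))"
      using x by (auto simp: inj_on_def carrier_bw_quot class_val_bw_class bw_class_eq_iff bw_rel_complete)
    show "class_val x ` carrier (bw_quot x) = carrier (End_alg Z2 (bool_fun x))"
      using val_surj[OF x] val_closed
      by (force simp: carrier_bw_quot image_image class_val_bw_class)
  qed
  fix c :: bit and P Q assume "P \<in> carrier (bw_quot x)"
  then obtain p where p: "P = bw_class x p" "p \<in> ops x" by (auto simp: carrier_bw_quot)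
  show "c \<odot>\<^bsub>bw_quot x\<^esub> P \<in> carrier (bw_quot x)"
    using p by (simp add: bw_quot_ops)
  have "val x p = (\<lambda>f\<in>extensional (cube x). \<lambda>g\<in>cube x. val x p f g)"
    using val_ext[OF p(2)] lin_mapsD(2)[OF val_closed[OF p(2)]]
    by (auto simp: fun_eq_iff extensional_def)
  moreover have "val x Wzero = (\<lambda>f\<in>extensional (cube x). \<lambda>g\<in>cube x. 0)"
    by (simp add: val.simps)
  ultimately show "class_val x (c \<odot>\<^bsub>bw_quot x\<^esub> P) = c \<odot>\<^bsub>End_alg Z2 (bool_fun x)\<^esub> class_val x P"
    using p by (cases "c = 0") (simp_all add: bw_quot_ops class_val_bw_class)
  assume "Q \<in> carrier (bw_quot x)"
  then obtain q where q: "Q = bw_class x q" "q \<in> ops x" by (auto simp: carrier_bw_quot)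
  show "P \<otimes>\<^bsub>bw_quot x\<^esub> Q \<in> carrier (bw_quot x)" "P \<oplus>\<^bsub>bw_quot x\<^esub> Q \<in> carrier (bw_quot x)"
    "class_val x (P \<otimes>\<^bsub>bw_quot x\<^esub> Q) = class_val x P \<otimes>\<^bsub>End_alg Z2 (bool_fun x)\<^esub> class_val x Q"
    "class_val x (P \<oplus>\<^bsub>bw_quot x\<^esub> Q) = class_val x P \<oplus>\<^bsub>End_alg Z2 (bool_fun x)\<^esub> class_val x Q"
    using p q by (simp_all add: bw_quot_ops class_val_bw_class val.simps(5,6))
qed (simp_all add: bw_quot_ops class_val_bw_class val.simps)

section \<open>Quotient modules\<close>

lemma quot_mod_simps:
  "carrier (quot_mod M N) = a_rcosets\<^bsub>M\<^esub> N"
  "\<zero>\<^bsub>quot_mod M N\<^esub> = N"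
  "C \<oplus>\<^bsub>quot_mod M N\<^esub> D = C <+>\<^bsub>M\<^esub> D"
  "c \<odot>\<^bsub>quot_mod M N\<^esub> C = (\<Union>x\<in>C. N +>\<^bsub>M\<^esub> (c \<odot>\<^bsub>M\<^esub> x))"
  by (simp_all add: quot_mod_def FactRing_def ring.defs module.defs)

text \<open>The cosets of a kernel are the fibres of the map. The module axioms of the quotient come from
  this bijection with the target.\<close>
lemma first_isomorphism:
  fixes M :: "('k, 'a) module" and B :: "('k, 'b) module"
  assumes M: "module K M" and B: "module K B" and \<Psi>: "\<Psi> \<in> lin_maps K M B"
    and surj: "\<Psi> ` carrier M = carrier B"
    and N: "N = {z \<in> carrier M. \<Psi> z = \<zero>\<^bsub>B\<^esub>}"
  defines "\<Psi>' \<equiv> (\<lambda>C\<in>carrier (quot_mod M N). the_elem (\<Psi> ` C))"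
  shows "module K (quot_mod M N)"
    and "\<Psi>' \<in> lin_maps K (quot_mod M N) B"
    and "bij_betw \<Psi>' (carrier (quot_mod M N)) (carrier B)"
    and "\<And>z. z \<in> carrier M \<Longrightarrow> N +>\<^bsub>M\<^esub> z \<in> carrier (quot_mod M N)"
    and "\<And>z. z \<in> carrier M \<Longrightarrow> \<Psi>' (N +>\<^bsub>M\<^esub> z) = \<Psi> z"
proof -
  interpret M: module K M by fact
  interpret B: module K B by fact
  note \<Psi>' = lin_mapsD[OF \<Psi>]
  define fib where "fib z = {w \<in> carrier M. \<Psi> w = \<Psi> z}" for z
  have minus: "\<Psi> (w \<ominus>\<^bsub>M\<^esub> z) = \<Psi> w \<ominus>\<^bsub>B\<^esub> \<Psi> z" if "w \<in> carrier M" "z \<in> carrier M" for w z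
  proof -
    have "\<Psi> (w \<ominus>\<^bsub>M\<^esub> z) \<oplus>\<^bsub>B\<^esub> \<Psi> z = \<Psi> w"
      using that by (simp add: M.M.minus_eq M.M.a_assoc M.M.l_neg flip: \<Psi>'(3))
    then show ?thesis
      using that \<Psi>'(1) by (metis B.M.add.inv_solve_right B.M.minus_eq M.M.minus_closed)
  qed
  have dec: "w = (w \<ominus>\<^bsub>M\<^esub> z) \<oplus>\<^bsub>M\<^esub> z" if "w \<in> carrier M" "z \<in> carrier M" for w z
    using that by (simp add: M.M.minus_eq M.M.a_assoc M.M.l_neg)
  have coset: "N +>\<^bsub>M\<^esub> z = fib z" if z: "z \<in> carrier M" for z
  proof (intro equalityI subsetI)
    fix w assume "w \<in> N +>\<^bsub>M\<^esub> z"
    then show "w \<in> fib z" using z by (auto simp: a_r_coset_def' N fib_def \<Psi>')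
  next
    fix w assume w: "w \<in> fib z"
    then have "w \<ominus>\<^bsub>M\<^esub> z \<in> N"
      using z by (simp add: N fib_def minus \<Psi>' B.M.minus_eq B.M.r_neg)
    then show "w \<in> N +>\<^bsub>M\<^esub> z"
      using dec[of w z] w z by (auto simp: a_r_coset_def' fib_def)
  qed
  have carr: "carrier (quot_mod M N) = fib ` carrier M"
    by (auto simp: quot_mod_simps A_RCOSETS_def' coset a_r_coset_def'[symmetric])
  have add: "fib z \<oplus>\<^bsub>quot_mod M N\<^esub> fib w = fib (z \<oplus>\<^bsub>M\<^esub> w)" if "z \<in> carrier M" "w \<in> carrier M" for z w
    unfolding quot_mod_simps
  proof (intro equalityI subsetI)
    fix u assume "u \<in> fib z <+>\<^bsub>M\<^esub> fib w"
    then show "u \<in> fib (z \<oplus>\<^bsub>M\<^esub> w)" using that by (auto simp: set_add_def' fib_def \<Psi>')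
  next
    fix u assume u: "u \<in> fib (z \<oplus>\<^bsub>M\<^esub> w)"
    then have "u \<ominus>\<^bsub>M\<^esub> w \<in> fib z"
      using that by (simp add: fib_def minus \<Psi>' B.M.minus_eq B.M.a_assoc B.M.r_neg)
    moreover have "w \<in> fib w" using that by (simp add: fib_def)
    ultimately show "u \<in> fib z <+>\<^bsub>M\<^esub> fib w"
      using dec[of u w] u that by (auto simp: set_add_def' fib_def)
  qed
  have smult: "c \<odot>\<^bsub>quot_mod M N\<^esub> fib z = fib (c \<odot>\<^bsub>M\<^esub> z)" if "c \<in> carrier K" "z \<in> carrier M" for c z
  proof -
    have "N +>\<^bsub>M\<^esub> (c \<odot>\<^bsub>M\<^esub> w) = fib (c \<odot>\<^bsub>M\<^esub> z)" if "w \<in> fib z" for w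
      using that \<open>c \<in> carrier K\<close> \<open>z \<in> carrier M\<close> by (simp add: coset fib_def \<Psi>')
    moreover have "z \<in> fib z" using that by (simp add: fib_def)
    ultimately show ?thesis unfolding quot_mod_simps by blast
  qed
  have zero: "\<zero>\<^bsub>quot_mod M N\<^esub> = fib \<zero>\<^bsub>M\<^esub>"
    by (simp add: quot_mod_simps N fib_def lin_maps_zero[OF \<Psi> M B])
  have val: "\<Psi>' (fib z) = \<Psi> z" if "z \<in> carrier M" for z
  proof -
    have "\<Psi> ` fib z = {\<Psi> z}" using that by (auto simp: fib_def)
    then show ?thesis using that by (simp add: \<Psi>'_def carr)
  qed
  show bij: "bij_betw \<Psi>' (carrier (quot_mod M N)) (carrier B)"
  proof (rule bij_betw_imageI)
    show "inj_on \<Psi>' (carrier (quot_mod M N))"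
      by (auto simp: inj_on_def carr val) (simp add: fib_def)+
    show "\<Psi>' ` carrier (quot_mod M N) = carrier B"
      by (simp add: carr image_image val flip: surj cong: image_cong)
  qed
  show "module K (quot_mod M N)"
    by (rule module_pullback[OF B bij])
      (auto simp: carr add smult zero val \<Psi>' lin_maps_zero[OF \<Psi> M B])
  show "\<Psi>' \<in> lin_maps K (quot_mod M N) B"
  proof (rule lin_mapsI)
    show "\<Psi>' C = undefined" if "C \<notin> carrier (quot_mod M N)" for C
      using that by (simp add: \<Psi>'_def)
  qed (auto simp: carr add smult val \<Psi>')
  show "N +>\<^bsub>M\<^esub> z \<in> carrier (quot_mod M N)" "\<Psi>' (N +>\<^bsub>M\<^esub> z) = \<Psi> z"
    if "z \<in> carrier M" for z
    using that by (simp_all add: coset carr val)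
qed

section \<open>Free modules\<close>

lemma free_mod_simps:
  "f \<in> carrier (free_mod K S) \<longleftrightarrow>
    (\<forall>s. f s \<in> carrier K) \<and> finite {s. f s \<noteq> \<zero>\<^bsub>K\<^esub>} \<and> {s. f s \<noteq> \<zero>\<^bsub>K\<^esub>} \<subseteq> S"
  "\<zero>\<^bsub>free_mod K S\<^esub> = (\<lambda>_. \<zero>\<^bsub>K\<^esub>)"
  "f \<oplus>\<^bsub>free_mod K S\<^esub> g = (\<lambda>s. f s \<oplus>\<^bsub>K\<^esub> g s)"
  "c \<odot>\<^bsub>free_mod K S\<^esub> f = (\<lambda>s. c \<otimes>\<^bsub>K\<^esub> f s)"
  by (simp_all add: free_mod_def)

lemma module_free_mod:
  assumes "cring K"
  shows "module K (free_mod K S)"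
proof -
  interpret K: cring K by fact
  have closed: "(\<lambda>s. f s \<oplus>\<^bsub>K\<^esub> g s) \<in> carrier (free_mod K S)"
    if "f \<in> carrier (free_mod K S)" "g \<in> carrier (free_mod K S)" for f g
  proof -
    have "{s. f s \<oplus>\<^bsub>K\<^esub> g s \<noteq> \<zero>\<^bsub>K\<^esub>} \<subseteq> {s. f s \<noteq> \<zero>\<^bsub>K\<^esub>} \<union> {s. g s \<noteq> \<zero>\<^bsub>K\<^esub>}" by auto
    then show ?thesis
      using that unfolding free_mod_simps by (auto intro: finite_subset)
  qed
  have smult: "(\<lambda>s. c \<otimes>\<^bsub>K\<^esub> f s) \<in> carrier (free_mod K S)"
    if "c \<in> carrier K" "f \<in> carrier (free_mod K S)" for c f
  proof -
    have "{s. c \<otimes>\<^bsub>K\<^esub> f s \<noteq> \<zero>\<^bsub>K\<^esub>} \<subseteq> {s. f s \<noteq> \<zero>\<^bsub>K\<^esub>}" using that by auto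
    then show ?thesis
      using that unfolding free_mod_simps by (auto intro: finite_subset)
  qed
  have val: "f s \<in> carrier K" if "f \<in> carrier (free_mod K S)" for f s
    using that by (simp add: free_mod_simps)
  have "abelian_group (free_mod K S)"
  proof (rule abelian_groupI)
    fix f assume f: "f \<in> carrier (free_mod K S)"
    have "(\<lambda>s. (\<ominus>\<^bsub>K\<^esub> \<one>\<^bsub>K\<^esub>) \<otimes>\<^bsub>K\<^esub> f s) \<in> carrier (free_mod K S)"
      using f by (intro smult) auto
    then show "\<exists>g\<in>carrier (free_mod K S). g \<oplus>\<^bsub>free_mod K S\<^esub> f = \<zero>\<^bsub>free_mod K S\<^esub>"
      by (rule bexI[rotated]) (use f in \<open>simp add: free_mod_simps(2-4) val K.l_minus K.l_neg\<close>)
  qed (simp_all add: free_mod_simps(2-4) closed val K.a_ac, simp add: free_mod_simps)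
  then show ?thesis
    by (intro moduleI assms)
      (simp_all add: free_mod_simps(2-4) smult val K.l_distr K.r_distr K.m_assoc)
qed

lemma free_gen_closed: "cring K \<Longrightarrow> s \<in> S \<Longrightarrow> free_gen K s \<in> carrier (free_mod K S)"
proof -
  assume "cring K" and s: "s \<in> S"
  then interpret K: cring K by simp
  have "{t. free_gen K s t \<noteq> \<zero>\<^bsub>K\<^esub>} \<subseteq> {s}" by (auto simp: free_gen_def)
  then show ?thesis
    using s finite_subset[of _ "{s}"] by (auto simp: free_mod_simps free_gen_def)
qed

lemma free_mod_generated:
  assumes K: "cring K" and N: "submodule N K (free_mod K S)"
    and gen: "\<And>s. s \<in> S \<Longrightarrow> free_gen K s \<in> N" and f: "f \<in> carrier (free_mod K S)"
  shows "f \<in> N"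
proof -
  interpret K: cring K by fact
  interpret F: module K "free_mod K S" by (rule module_free_mod[OF K])
  note sub = F.submoduleE[OF N]
  have *: "f \<in> N" if "finite A" "A \<subseteq> S" "\<And>s. f s \<in> carrier K" "\<And>s. s \<notin> A \<Longrightarrow> f s = \<zero>\<^bsub>K\<^esub>" for A f
    using that
  proof (induction A arbitrary: f)
    case empty
    obtain z where z: "z \<in> N" using sub(2) by blast
    then have "z \<in> carrier (free_mod K S)" using sub(1) by blast
    have "f = \<zero>\<^bsub>K\<^esub> \<odot>\<^bsub>free_mod K S\<^esub> z"
      using empty \<open>z \<in> carrier (free_mod K S)\<close> by (auto simp: F.smult_l_null free_mod_simps(2))
    then show ?case using sub(4)[OF _ z] by simp
  next
    case (insert s A)
    define f' where "f' = f(s := \<zero>\<^bsub>K\<^esub>)"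
    have "f' \<in> N"
      by (rule insert.IH) (use insert.prems in \<open>auto simp: f'_def\<close>)
    moreover have "f s \<odot>\<^bsub>free_mod K S\<^esub> free_gen K s \<in> N"
      using insert.prems by (intro sub(4) gen) auto
    moreover have "f = f' \<oplus>\<^bsub>free_mod K S\<^esub> (f s \<odot>\<^bsub>free_mod K S\<^esub> free_gen K s)"
      using insert.prems by (auto simp: f'_def free_mod_simps free_gen_def)
    ultimately show ?case using sub(5) by metis
  qed
  show ?thesis
  proof (rule *)
    show "finite {s. f s \<noteq> \<zero>\<^bsub>K\<^esub>}" "{s. f s \<noteq> \<zero>\<^bsub>K\<^esub>} \<subseteq> S" "f s \<in> carrier K" for s
      using f by (simp_all add: free_mod_simps)
  qed simp
qed

section \<open>Tensor powers of the functions of one bit\<close>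

text \<open>Keeps the index sets \<open>{1}\<close> and \<open>{1..n}\<close> in the form in which they occur in the statements.\<close>
declare One_nat_def [simp del]

abbreviation (input) V1 :: "(bit, (nat \<Rightarrow> bit) \<Rightarrow> bit) module" where
  "V1 \<equiv> bool_fun {1}"

definition bit_point :: "bit \<Rightarrow> nat \<Rightarrow> bit" where
  "bit_point b = (\<lambda>_\<in>{1}. b)"

lemma bit_point_cube [simp]: "bit_point b \<in> cube {1}"
  by (simp add: bit_point_def)

lemma cube_1: "cube {1::nat} = range bit_point"
proof (intro equalityI subsetI)
  fix g assume g: "g \<in> cube {1::nat}"
  have "g = bit_point (g 1)"
  proof
    fix a show "g a = bit_point (g 1) a"
      using g by (cases "a = 1") (auto simp: bit_point_def PiE_def extensional_def)
  qed
  then show "g \<in> range bit_point" by simp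
next
  fix g assume "g \<in> range bit_point"
  then show "g \<in> cube {1}" by (metis bit_point_cube imageE)
qed

lemma bit_point_eq_iff [simp]: "bit_point b = bit_point c \<longleftrightarrow> b = c"
  by (auto simp: bit_point_def dest: fun_cong[of _ _ 1])

definition bit_delta :: "bit \<Rightarrow> (nat \<Rightarrow> bit) \<Rightarrow> bit" where
  "bit_delta b = point_fun {1} (bit_point b)"

lemma bit_delta_point [simp]: "bit_delta b (bit_point c) = (if c = b then 1 else 0)"
  by (simp add: bit_delta_def point_fun_def)

lemma bit_delta_closed [simp]: "bit_delta b \<in> extensional (cube {1})"
  by (simp add: bit_delta_def)

lemma V1_eqI:
  assumes "u \<in> extensional (cube {1::nat})" "v \<in> extensional (cube {1})"
    "\<And>b. u (bit_point b) = v (bit_point b)"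
  shows "u = v"
proof (rule extensionalityI[OF assms(1,2)])
  fix g assume "g \<in> cube {1::nat}"
  then obtain b where "g = bit_point b" unfolding cube_1 by blast
  then show "u g = v g" by (simp only: assms(3))
qed

text \<open>Each of the four functions of one bit is an indicator, or a scalar multiple of one, or the sum of
  both. This is what lets every slot of a tuple be expanded by at most one multilinear relation.\<close>
lemma V1_cases:
  assumes v: "v \<in> extensional (cube {1::nat})"
  shows "(\<exists>b. v = bit_delta b) \<or> v = 0 \<odot>\<^bsub>V1\<^esub> bit_delta 0 \<or> v = bit_delta 0 \<oplus>\<^bsub>V1\<^esub> bit_delta 1"
proof -
  have "v = w" if "w \<in> extensional (cube {1})" "v (bit_point 0) = w (bit_point 0)"
    "v (bit_point 1) = w (bit_point 1)" for w
  proof (rule V1_eqI[OF v that(1)])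
    show "v (bit_point b) = w (bit_point b)" for b using that(2,3) by (cases b) simp_all
  qed
  note eq = this
  consider "v (bit_point 0) = 0" "v (bit_point 1) = 0" | "v (bit_point 0) = 0" "v (bit_point 1) = 1"
    | "v (bit_point 0) = 1" "v (bit_point 1) = 0" | "v (bit_point 0) = 1" "v (bit_point 1) = 1"
    by (cases "v (bit_point 0)"; cases "v (bit_point 1)") auto
  then show ?thesis
  proof cases
    case 1
    then have "v = 0 \<odot>\<^bsub>V1\<^esub> bit_delta 0" by (intro eq) simp_all
    then show ?thesis by blast
  next
    case 2
    then have "v = bit_delta 1" by (intro eq) simp_all
    then show ?thesis by blast
  next
    case 3
    then have "v = bit_delta 0" by (intro eq) simp_all
    then show ?thesis by blast
  next
    case 4
    then have "v = bit_delta 0 \<oplus>\<^bsub>V1\<^esub> bit_delta 1" by (intro eq) simp_all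
    then show ?thesis by blast
  qed
qed

text \<open>The function of \<open>n\<close> bits that corresponds to \<open>t\<^sub>1 \<otimes> \<dots> \<otimes> t\<^sub>n\<close>.\<close>
definition pure_fun :: "nat \<Rightarrow> (nat \<Rightarrow> (nat \<Rightarrow> bit) \<Rightarrow> bit) \<Rightarrow> (nat \<Rightarrow> bit) \<Rightarrow> bit" where
  "pure_fun n t = (\<lambda>g\<in>cube {1..n}. \<Prod>i\<in>{1..n}. t i (bit_point (g i)))"

definition delta_tuple :: "nat \<Rightarrow> (nat \<Rightarrow> bit) \<Rightarrow> nat \<Rightarrow> (nat \<Rightarrow> bit) \<Rightarrow> bit" where
  "delta_tuple n g = (\<lambda>i\<in>{1..n}. bit_delta (g i))"

lemma delta_tuple_closed [simp]: "delta_tuple n g \<in> tuples V1 n"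
  by (simp add: delta_tuple_def)

lemma pure_fun_closed [simp]: "pure_fun n t \<in> extensional (cube {1..n})"
  by (simp add: pure_fun_def)

lemma pure_fun_delta_tuple:
  assumes "g \<in> cube {1..n}"
  shows "pure_fun n (delta_tuple n g) = point_fun {1..n} g"
  unfolding pure_fun_def point_fun_def
proof (rule restrict_ext)
  fix h assume h: "h \<in> cube {1..n}"
  have "(\<Prod>i\<in>{1..n}. delta_tuple n g i (bit_point (h i))) = (\<Prod>i\<in>{1..n}. if h i = g i then 1 else 0)"
    by (intro prod.cong) (simp_all add: delta_tuple_def)
  also have "\<dots> = (if h = g then 1 else 0)"
  proof (cases "h = g")
    case False
    then obtain i where "i \<in> {1..n}" "h i \<noteq> g i"
      using assms h by (metis PiE_ext)
    then have "(\<Prod>i\<in>{1..n}. if h i = g i then 1 else 0 :: bit) = 0"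
      by (intro prod_zero) (auto intro!: bexI[of _ i])
    with False show ?thesis by simp
  qed simp
  finally show "(\<Prod>i\<in>{1..n}. delta_tuple n g i (bit_point (h i))) = (if h = g then 1 else 0)" .
qed

lemma pure_fun_upd:
  assumes "i \<in> {1..n}" "g \<in> cube {1..n}"
  shows "pure_fun n (t(i := u)) g = u (bit_point (g i)) * (\<Prod>j\<in>{1..n} - {i}. t j (bit_point (g j)))"
proof -
  have "(\<Prod>j\<in>{1..n} - {i}. (t(i := u)) j (bit_point (g j))) = (\<Prod>j\<in>{1..n} - {i}. t j (bit_point (g j)))"
    by (intro prod.cong) auto
  then show ?thesis
    using assms by (simp add: pure_fun_def prod.remove[of _ i])
qed

lemma finite_tuples: "finite (tuples V1 n)"
proof -
  have "finite (cube {1::nat} \<rightarrow>\<^sub>E (UNIV :: bit set))"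
    using finite_UNIV_bit by (intro finite_PiE finite_cube) simp_all
  then have "finite (carrier V1)" by (simp add: PiE_def)
  then show ?thesis by (intro finite_PiE) auto
qed

text \<open>The linear extension of \<^const>\<open>pure_fun\<close> to the free module over the tuples. Its restriction to
  the carrier makes it an element of \<^const>\<open>lin_maps\<close>.\<close>
definition multiply_out :: "nat \<Rightarrow> ((nat \<Rightarrow> (nat \<Rightarrow> bit) \<Rightarrow> bit) \<Rightarrow> bit) \<Rightarrow> (nat \<Rightarrow> bit) \<Rightarrow> bit" where
  "multiply_out n = (\<lambda>z\<in>carrier (tuple_mod Z2 V1 n). \<lambda>g\<in>cube {1..n}.
     \<Sum>t\<in>tuples V1 n. z t * pure_fun n t g)"

text \<open>A linear section of \<^const>\<open>multiply_out\<close>: it writes a function as a combination of indicators of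
  points, each of them the image of a tuple of indicators.\<close>
definition delta_section :: "nat \<Rightarrow> ((nat \<Rightarrow> bit) \<Rightarrow> bit) \<Rightarrow> (nat \<Rightarrow> (nat \<Rightarrow> bit) \<Rightarrow> bit) \<Rightarrow> bit" where
  "delta_section n = (\<lambda>f\<in>carrier (bool_fun {1..n}). \<lambda>s.
     \<Sum>g\<in>cube {1..n}. f g * (if s = delta_tuple n g then 1 else 0))"

lemma tuple_mod_carrier:
  "z \<in> carrier (tuple_mod Z2 V1 n) \<longleftrightarrow> (\<forall>s. s \<notin> tuples V1 n \<longrightarrow> z s = 0)"
proof
  assume *: "\<forall>s. s \<notin> tuples V1 n \<longrightarrow> z s = 0"
  then have "{s. z s \<noteq> 0} \<subseteq> tuples V1 n" by blast
  moreover from this have "finite {s. z s \<noteq> 0}" using finite_tuples by (rule finite_subset)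
  ultimately show "z \<in> carrier (tuple_mod Z2 V1 n)"
    by (simp only: free_mod_simps Z2_simps UNIV_I simp_thms)
qed (auto simp only: free_mod_simps Z2_simps)

lemma multiply_out_lin: "multiply_out n \<in> lin_maps Z2 (tuple_mod Z2 V1 n) (bool_fun {1..n})"
proof (rule lin_mapsI)
  interpret F: module Z2 "tuple_mod Z2 V1 n" by (rule module_free_mod[OF cring_Z2])
  show "multiply_out n z \<in> carrier (bool_fun {1..n})" if "z \<in> carrier (tuple_mod Z2 V1 n)" for z
    using that by (simp add: multiply_out_def)
  show "multiply_out n z = undefined" if "z \<notin> carrier (tuple_mod Z2 V1 n)" for z
    using that by (simp add: multiply_out_def)
  fix z assume z: "z \<in> carrier (tuple_mod Z2 V1 n)"
  have mo: "multiply_out n y = (\<lambda>g\<in>cube {1..n}. \<Sum>t\<in>tuples V1 n. y t * pure_fun n t g)"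
    if "y \<in> carrier (tuple_mod Z2 V1 n)" for y
    using that by (simp only: multiply_out_def restrict_apply')
  show "multiply_out n (c \<odot>\<^bsub>tuple_mod Z2 V1 n\<^esub> z) = c \<odot>\<^bsub>bool_fun {1..n}\<^esub> multiply_out n z"
    if "c \<in> carrier Z2" for c
    unfolding mo[OF z] mo[OF F.smult_closed[OF that z]] bool_fun_simps(2-)
    by (rule restrict_ext) (simp only: free_mod_simps Z2_simps restrict_apply' sum_distrib_left mult.assoc)
  fix y assume y: "y \<in> carrier (tuple_mod Z2 V1 n)"
  show "multiply_out n (z \<oplus>\<^bsub>tuple_mod Z2 V1 n\<^esub> y) = multiply_out n z \<oplus>\<^bsub>bool_fun {1..n}\<^esub> multiply_out n y"
    unfolding mo[OF z] mo[OF y] mo[OF F.M.a_closed[OF z y]] bool_fun_simps(2-)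
    by (rule restrict_ext)
      (simp only: free_mod_simps Z2_simps restrict_apply' sum.distrib semiring_class.distrib_right)
qed

lemma multiply_out_free_gen:
  assumes t: "t \<in> tuples V1 n"
  shows "multiply_out n (free_gen Z2 t) = pure_fun n t"
proof (rule extensionalityI[where A = "cube {1..n}"])
  have c: "free_gen Z2 t \<in> carrier (tuple_mod Z2 V1 n)"
    by (rule free_gen_closed[OF cring_Z2 t])
  then show "multiply_out n (free_gen Z2 t) \<in> extensional (cube {1..n})"
    using lin_mapsD(1)[OF multiply_out_lin] by simp
  fix g assume g: "g \<in> cube {1..n}"
  have "multiply_out n (free_gen Z2 t) g = (\<Sum>s\<in>tuples V1 n. free_gen Z2 t s * pure_fun n s g)"
    using g c by (simp only: multiply_out_def restrict_apply')
  also have "\<dots> = (\<Sum>s\<in>tuples V1 n. if s = t then pure_fun n s g else 0)"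
    by (intro sum.cong) (simp_all add: free_gen_def)
  also have "\<dots> = pure_fun n t g"
    using t finite_tuples by (simp only: sum.delta if_True)
  finally show "multiply_out n (free_gen Z2 t) g = pure_fun n t g" .
qed simp

lemma delta_section_lin: "delta_section n \<in> lin_maps Z2 (bool_fun {1..n}) (tuple_mod Z2 V1 n)"
proof (rule lin_mapsI)
  interpret B: module Z2 "bool_fun {1..n}" by (rule module_bool_fun)
  have ds: "delta_section n f = (\<lambda>s. \<Sum>g\<in>cube {1..n}. f g * (if s = delta_tuple n g then 1 else 0))"
    if "f \<in> carrier (bool_fun {1..n})" for f
    using that by (simp only: delta_section_def restrict_apply')
  show "delta_section n f = undefined" if "f \<notin> carrier (bool_fun {1..n})" for f
    using that by (simp add: delta_section_def)
  fix f assume f: "f \<in> carrier (bool_fun {1..n})"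
  show "delta_section n f \<in> carrier (tuple_mod Z2 V1 n)"
    unfolding ds[OF f] tuple_mod_carrier
  proof (intro allI impI)
    fix s assume "s \<notin> tuples V1 n"
    then have "s \<noteq> delta_tuple n g" for g using delta_tuple_closed by metis
    then show "(\<Sum>g\<in>cube {1..n}. f g * (if s = delta_tuple n g then 1 else 0)) = 0" by simp
  qed
  show "delta_section n (c \<odot>\<^bsub>bool_fun {1..n}\<^esub> f) = c \<odot>\<^bsub>tuple_mod Z2 V1 n\<^esub> delta_section n f"
    if "c \<in> carrier Z2" for c
    unfolding ds[OF f] ds[OF B.smult_closed[OF that f]] free_mod_simps Z2_simps
    by (rule ext) (simp only: sum_distrib_left, intro sum.cong, simp_all only: bool_fun_simps restrict_apply' mult.assoc)
  fix h assume h: "h \<in> carrier (bool_fun {1..n})"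
  show "delta_section n (f \<oplus>\<^bsub>bool_fun {1..n}\<^esub> h) = delta_section n f \<oplus>\<^bsub>tuple_mod Z2 V1 n\<^esub> delta_section n h"
    unfolding ds[OF f] ds[OF h] ds[OF B.M.a_closed[OF f h]] free_mod_simps Z2_simps
    by (rule ext) (simp only: sum.distrib [symmetric], intro sum.cong,
      simp_all only: bool_fun_simps restrict_apply' semiring_class.distrib_right)
qed

lemma delta_section_point_fun:
  assumes g: "g \<in> cube {1..n}"
  shows "delta_section n (point_fun {1..n} g) = free_gen Z2 (delta_tuple n g)"
proof
  fix s
  have "delta_section n (point_fun {1..n} g) s =
      (\<Sum>h\<in>cube {1..n}. point_fun {1..n} g h * (if s = delta_tuple n h then 1 else 0))"
    by (simp add: delta_section_def)
  also have "\<dots> = (\<Sum>h\<in>cube {1..n}. if h = g then (if s = delta_tuple n h then 1 else 0) else 0)"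
    by (intro sum.cong) (simp_all add: point_fun_def)
  also have "\<dots> = free_gen Z2 (delta_tuple n g) s"
    using g by (simp add: sum.delta free_gen_def)
  finally show "delta_section n (point_fun {1..n} g) s = free_gen Z2 (delta_tuple n g) s" .
qed

lemma multiply_out_delta_section:
  assumes f: "f \<in> carrier (bool_fun {1..n})"
  shows "multiply_out n (delta_section n f) = f"
proof -
  have "compose (carrier (bool_fun {1..n})) (multiply_out n) (delta_section n) = (\<lambda>f\<in>carrier (bool_fun {1..n}). f)"
  proof (rule bool_fun_lin_maps_eqI[OF _ module_bool_fun])
    show "compose (carrier (bool_fun {1..n})) (multiply_out n) (delta_section n)
        \<in> lin_maps Z2 (bool_fun {1..n}) (bool_fun {1..n})"
      by (rule lin_maps_compose[OF delta_section_lin multiply_out_lin module_bool_fun])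
    show "(\<lambda>f\<in>carrier (bool_fun {1..n}). f) \<in> lin_maps Z2 (bool_fun {1..n}) (bool_fun {1..n})"
      by (rule End_alg_closed(3)[OF module_bool_fun])
    show "compose (carrier (bool_fun {1..n})) (multiply_out n) (delta_section n) (point_fun {1..n} g) =
        (\<lambda>f\<in>carrier (bool_fun {1..n}). f) (point_fun {1..n} g)" if "g \<in> cube {1..n}" for g
      using that
      by (simp add: compose_def delta_section_point_fun multiply_out_free_gen[OF delta_tuple_closed]
          pure_fun_delta_tuple)
  qed simp
  from fun_cong[OF this, of f] f show ?thesis by (simp only: compose_def restrict_apply')
qed

text \<open>A product of values, one for each slot, is additive and homogeneous in each slot.\<close>
lemma multilinear_rels_kernel:
  "multilinear_rels Z2 V1 n \<subseteq>
    {z \<in> carrier (tuple_mod Z2 V1 n). multiply_out n z = \<zero>\<^bsub>bool_fun {1..n}\<^esub>}"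
proof -
  interpret F: module Z2 "tuple_mod Z2 V1 n" by (rule module_free_mod[OF cring_Z2])
  interpret B: module Z2 "bool_fun {1..n}" by (rule module_bool_fun)
  interpret V: module Z2 V1 by (rule module_bool_fun)
  note lin = lin_mapsD[OF multiply_out_lin]
  note gen = free_gen_closed[OF cring_Z2, of _ "tuples V1 n"]
  have upd: "t(i := u) \<in> tuples V1 n" if "t \<in> tuples V1 n" "i \<in> {1..n}" "u \<in> carrier V1" for t i u
    using that by (auto simp: PiE_def extensional_def simp del: bool_fun_simps)
  have ker: "z \<ominus>\<^bsub>tuple_mod Z2 V1 n\<^esub> w \<in> {z \<in> carrier (tuple_mod Z2 V1 n). multiply_out n z = \<zero>\<^bsub>bool_fun {1..n}\<^esub>}"
    if z: "z \<in> carrier (tuple_mod Z2 V1 n)" and w: "w \<in> carrier (tuple_mod Z2 V1 n)"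
      and eq: "multiply_out n z = multiply_out n w" for z w
  proof -
    have "multiply_out n (z \<ominus>\<^bsub>tuple_mod Z2 V1 n\<^esub> w) \<oplus>\<^bsub>bool_fun {1..n}\<^esub> multiply_out n w =
        multiply_out n ((z \<ominus>\<^bsub>tuple_mod Z2 V1 n\<^esub> w) \<oplus>\<^bsub>tuple_mod Z2 V1 n\<^esub> w)"
      by (rule lin(3)[symmetric, OF F.M.minus_closed[OF z w] w])
    also have "(z \<ominus>\<^bsub>tuple_mod Z2 V1 n\<^esub> w) \<oplus>\<^bsub>tuple_mod Z2 V1 n\<^esub> w = z"
      using z w by (simp only: F.M.minus_eq F.M.a_assoc F.M.l_neg F.M.a_inv_closed F.M.r_zero)
    finally have "multiply_out n (z \<ominus>\<^bsub>tuple_mod Z2 V1 n\<^esub> w) = \<zero>\<^bsub>bool_fun {1..n}\<^esub>"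
      using lin(1)[OF w] lin(1)[OF F.M.minus_closed[OF z w]] unfolding eq
      by (simp only: B.M.add.r_cancel_one)
    then show ?thesis using F.M.minus_closed[OF z w] by blast
  qed
  show ?thesis
    unfolding multilinear_rels_def
  proof (intro Un_least subsetI)
    fix z assume "z \<in> {free_gen Z2 (t(i := u \<oplus>\<^bsub>V1\<^esub> v)) \<ominus>\<^bsub>tuple_mod Z2 V1 n\<^esub>
        (free_gen Z2 (t(i := u)) \<oplus>\<^bsub>tuple_mod Z2 V1 n\<^esub> free_gen Z2 (t(i := v)))
      | t i u v. t \<in> tuples V1 n \<and> i \<in> {1..n} \<and> u \<in> carrier V1 \<and> v \<in> carrier V1}"
    then obtain t i u v where t: "t \<in> tuples V1 n" "i \<in> {1..n}" "u \<in> carrier V1" "v \<in> carrier V1"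
      and z: "z = free_gen Z2 (t(i := u \<oplus>\<^bsub>V1\<^esub> v)) \<ominus>\<^bsub>tuple_mod Z2 V1 n\<^esub>
        (free_gen Z2 (t(i := u)) \<oplus>\<^bsub>tuple_mod Z2 V1 n\<^esub> free_gen Z2 (t(i := v)))" by blast
    note up = upd[OF t(1,2,3)] upd[OF t(1,2,4)] upd[OF t(1,2) V.M.a_closed[OF t(3,4)]]
    have "pure_fun n (t(i := u \<oplus>\<^bsub>V1\<^esub> v)) = pure_fun n (t(i := u)) \<oplus>\<^bsub>bool_fun {1..n}\<^esub> pure_fun n (t(i := v))"
      by (rule extensionalityI[where A = "cube {1..n}"])
        (simp_all only: pure_fun_upd[OF t(2)] pure_fun_closed bool_fun_simps restrict_extensional restrict_apply' bit_point_cube semiring_class.distrib_right)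
    then show "z \<in> {z \<in> carrier (tuple_mod Z2 V1 n). multiply_out n z = \<zero>\<^bsub>bool_fun {1..n}\<^esub>}"
      unfolding z using up
      by (intro ker) (simp_all only: gen lin(3) multiply_out_free_gen F.M.a_closed)
  next
    fix z assume "z \<in> {free_gen Z2 (t(i := c \<odot>\<^bsub>V1\<^esub> u)) \<ominus>\<^bsub>tuple_mod Z2 V1 n\<^esub>
        (c \<odot>\<^bsub>tuple_mod Z2 V1 n\<^esub> free_gen Z2 (t(i := u)))
      | t i c u. t \<in> tuples V1 n \<and> i \<in> {1..n} \<and> c \<in> carrier Z2 \<and> u \<in> carrier V1}"
    then obtain t i c u where t: "t \<in> tuples V1 n" "i \<in> {1..n}" "u \<in> carrier V1" "c \<in> carrier Z2"
      and z: "z = free_gen Z2 (t(i := c \<odot>\<^bsub>V1\<^esub> u)) \<ominus>\<^bsub>tuple_mod Z2 V1 n\<^esub>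
        (c \<odot>\<^bsub>tuple_mod Z2 V1 n\<^esub> free_gen Z2 (t(i := u)))" by blast
    note up = upd[OF t(1,2,3)] upd[OF t(1,2) V.smult_closed[OF t(4,3)]]
    have "pure_fun n (t(i := c \<odot>\<^bsub>V1\<^esub> u)) = c \<odot>\<^bsub>bool_fun {1..n}\<^esub> pure_fun n (t(i := u))"
      by (rule extensionalityI[where A = "cube {1..n}"])
        (simp_all only: pure_fun_upd[OF t(2)] pure_fun_closed bool_fun_simps restrict_extensional restrict_apply' bit_point_cube mult.assoc)
    then show "z \<in> {z \<in> carrier (tuple_mod Z2 V1 n). multiply_out n z = \<zero>\<^bsub>bool_fun {1..n}\<^esub>}"
      unfolding z using up t(4)
      by (intro ker) (simp_all only: gen lin(4) multiply_out_free_gen F.smult_closed)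
  qed
qed

lemma submodule_zero: "submodule N K M \<Longrightarrow> \<zero>\<^bsub>M\<^esub> \<in> N"
  using subgroup.one_closed[OF submodule.axioms(1)] by fastforce

lemma submodule_multilinear:
  "submodule (multilinear_submod Z2 V1 n) Z2 (tuple_mod Z2 V1 n)"
  "multilinear_rels Z2 V1 n \<subseteq> multilinear_submod Z2 V1 n"
proof -
  interpret F: module Z2 "tuple_mod Z2 V1 n" by (rule module_free_mod[OF cring_Z2])
  let ?S = "{N. submodule N Z2 (tuple_mod Z2 V1 n) \<and> multilinear_rels Z2 V1 n \<subseteq> N}"
  show "multilinear_rels Z2 V1 n \<subseteq> multilinear_submod Z2 V1 n"
    unfolding multilinear_submod_def by blast
  have whole: "carrier (tuple_mod Z2 V1 n) \<in> ?S"
    using F.carrier_is_submodule multilinear_rels_kernel[of n] by blast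
  show "submodule (multilinear_submod Z2 V1 n) Z2 (tuple_mod Z2 V1 n)"
    unfolding multilinear_submod_def
  proof (rule F.submoduleI)
    show "\<Inter> ?S \<subseteq> carrier (tuple_mod Z2 V1 n)" using whole by blast
    show "\<zero>\<^bsub>tuple_mod Z2 V1 n\<^esub> \<in> \<Inter> ?S"
      using submodule_zero by blast
    show "\<ominus>\<^bsub>tuple_mod Z2 V1 n\<^esub> a \<in> \<Inter> ?S" if "a \<in> \<Inter> ?S" for a
      using that F.submoduleE(3) by blast
    show "a \<oplus>\<^bsub>tuple_mod Z2 V1 n\<^esub> b \<in> \<Inter> ?S" if "a \<in> \<Inter> ?S" "b \<in> \<Inter> ?S" for a b
      using that F.submoduleE(5) by blast
    show "c \<odot>\<^bsub>tuple_mod Z2 V1 n\<^esub> a \<in> \<Inter> ?S" if "c \<in> carrier Z2" "a \<in> \<Inter> ?S" for c a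
      using that F.submoduleE(4) by blast
  qed
qed

lemma multilinear_rels_add:
  assumes "t \<in> tuples M n" "i \<in> {1..n}" "u \<in> carrier M" "v \<in> carrier M"
  shows "free_gen K (t(i := u \<oplus>\<^bsub>M\<^esub> v)) \<ominus>\<^bsub>tuple_mod K M n\<^esub>
      (free_gen K (t(i := u)) \<oplus>\<^bsub>tuple_mod K M n\<^esub> free_gen K (t(i := v)))
      \<in> multilinear_rels K M n"
  unfolding multilinear_rels_def
  by (rule UnI1, rule CollectI, rule exI[of _ t], rule exI[of _ i], rule exI[of _ u],
      rule exI[of _ v], intro conjI HOL.refl assms)

lemma multilinear_rels_smult:
  assumes "t \<in> tuples M n" "i \<in> {1..n}" "c \<in> carrier K" "u \<in> carrier M"
  shows "free_gen K (t(i := c \<odot>\<^bsub>M\<^esub> u)) \<ominus>\<^bsub>tuple_mod K M n\<^esub>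
      (c \<odot>\<^bsub>tuple_mod K M n\<^esub> free_gen K (t(i := u))) \<in> multilinear_rels K M n"
  unfolding multilinear_rels_def
  by (rule UnI2, rule CollectI, rule exI[of _ t], rule exI[of _ i], rule exI[of _ c],
      rule exI[of _ u], intro conjI HOL.refl assms)

lemma submodule_kernel:
  assumes M: "module K M" and B: "module K B" and \<Psi>: "\<Psi> \<in> lin_maps K M B"
  shows "submodule {z \<in> carrier M. \<Psi> z = \<zero>\<^bsub>B\<^esub>} K M"
proof -
  interpret M: module K M by fact
  interpret B: module K B by fact
  note lin = lin_mapsD[OF \<Psi>]
  show ?thesis
  proof (rule M.submoduleI)
    fix a assume a: "a \<in> {z \<in> carrier M. \<Psi> z = \<zero>\<^bsub>B\<^esub>}"
    have "\<Psi> (\<ominus>\<^bsub>M\<^esub> a) \<oplus>\<^bsub>B\<^esub> \<Psi> a = \<Psi> (\<ominus>\<^bsub>M\<^esub> a \<oplus>\<^bsub>M\<^esub> a)"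
      using a by (simp add: lin)
    then have "\<Psi> (\<ominus>\<^bsub>M\<^esub> a) = \<zero>\<^bsub>B\<^esub>"
      using a by (simp add: lin M.M.l_neg lin_maps_zero[OF \<Psi> M B])
    then show "\<ominus>\<^bsub>M\<^esub> a \<in> {z \<in> carrier M. \<Psi> z = \<zero>\<^bsub>B\<^esub>}" using a by simp
  qed (auto simp: lin lin_maps_zero[OF \<Psi> M B])
qed

text \<open>For the difficult inclusion, consider the elements that differ from the section of their image
  by a multilinear relation (in characteristic two the difference is a sum). They form a submodule.
  It contains all tuples of indicators, where the difference vanishes, and then all tuples, by
  expanding one slot after the other. Hence it is everything, and an element of the kernel differs
  by a relation from the section of zero.\<close>
lemma multilinear_submod_eq_kernel:
  "multilinear_submod Z2 V1 n =
    {z \<in> carrier (tuple_mod Z2 V1 n). multiply_out n z = \<zero>\<^bsub>bool_fun {1..n}\<^esub>}" (is "?N = ?Ker")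
proof
  interpret F: module Z2 "tuple_mod Z2 V1 n" by (rule module_free_mod[OF cring_Z2])
  interpret B: module Z2 "bool_fun {1..n}" by (rule module_bool_fun)
  interpret V: module Z2 V1 by (rule module_bool_fun)
  note N = submodule_multilinear[of n]
  note subN = F.submoduleE[OF N(1)]
  note mo = lin_mapsD[OF multiply_out_lin]
  note ds = lin_mapsD[OF delta_section_lin]
  show NK: "?N \<subseteq> ?Ker"
    using submodule_kernel[OF F.module_axioms B.module_axioms multiply_out_lin] multilinear_rels_kernel[of n]
    unfolding multilinear_submod_def by blast
  \<comment> \<open>The elements \<open>z\<close> that are congruent to the section of their image.\<close>
  define N' where "N' = {z \<in> carrier (tuple_mod Z2 V1 n).
    z \<oplus>\<^bsub>tuple_mod Z2 V1 n\<^esub> delta_section n (multiply_out n z) \<in> ?N}"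
  have self: "z \<oplus>\<^bsub>tuple_mod Z2 V1 n\<^esub> z = \<zero>\<^bsub>tuple_mod Z2 V1 n\<^esub>" for z
    by (simp only: free_mod_simps Z2_simps bit_add_self)
  have neg: "\<ominus>\<^bsub>tuple_mod Z2 V1 n\<^esub> z = z" if "z \<in> carrier (tuple_mod Z2 V1 n)" for z
    using F.M.minus_equality[OF self that that] .
  have N'_sub: "submodule N' Z2 (tuple_mod Z2 V1 n)"
  proof (rule F.submoduleI)
    fix a assume a: "a \<in> N'"
    then show "\<ominus>\<^bsub>tuple_mod Z2 V1 n\<^esub> a \<in> N'" by (simp only: N'_def mem_Collect_eq neg)
    fix c assume c: "c \<in> carrier Z2"
    have "c \<odot>\<^bsub>tuple_mod Z2 V1 n\<^esub> a \<oplus>\<^bsub>tuple_mod Z2 V1 n\<^esub> delta_section n (multiply_out n (c \<odot>\<^bsub>tuple_mod Z2 V1 n\<^esub> a)) =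
        c \<odot>\<^bsub>tuple_mod Z2 V1 n\<^esub> (a \<oplus>\<^bsub>tuple_mod Z2 V1 n\<^esub> delta_section n (multiply_out n a))"
      using a c by (simp only: N'_def mem_Collect_eq mo ds F.smult_r_distr)
    then show "c \<odot>\<^bsub>tuple_mod Z2 V1 n\<^esub> a \<in> N'"
      using a c subN(4) unfolding N'_def mem_Collect_eq by (metis F.smult_closed)
  next
    fix a b assume ab: "a \<in> N'" "b \<in> N'"
    have "(a \<oplus>\<^bsub>tuple_mod Z2 V1 n\<^esub> b) \<oplus>\<^bsub>tuple_mod Z2 V1 n\<^esub> delta_section n (multiply_out n (a \<oplus>\<^bsub>tuple_mod Z2 V1 n\<^esub> b)) =
        (a \<oplus>\<^bsub>tuple_mod Z2 V1 n\<^esub> delta_section n (multiply_out n a)) \<oplus>\<^bsub>tuple_mod Z2 V1 n\<^esub>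
        (b \<oplus>\<^bsub>tuple_mod Z2 V1 n\<^esub> delta_section n (multiply_out n b))"
      using ab by (simp only: N'_def mem_Collect_eq mo ds F.M.a_ac F.M.a_closed)
    then show "a \<oplus>\<^bsub>tuple_mod Z2 V1 n\<^esub> b \<in> N'"
      using ab subN(5) unfolding N'_def mem_Collect_eq by (metis F.M.a_closed)
  next
    have "\<zero>\<^bsub>tuple_mod Z2 V1 n\<^esub> \<in> ?N"
      by (rule submodule_zero[OF N(1)])
    then show "\<zero>\<^bsub>tuple_mod Z2 V1 n\<^esub> \<in> N'"
      unfolding N'_def mem_Collect_eq lin_maps_zero[OF multiply_out_lin F.module_axioms B.module_axioms]
        lin_maps_zero[OF delta_section_lin B.module_axioms F.module_axioms]
      by (simp only: F.M.zero_closed F.M.r_zero simp_thms)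
  qed (auto simp: N'_def)
  have N_N': "?N \<subseteq> N'"
  proof
    fix z assume z: "z \<in> ?N"
    then have "z \<in> carrier (tuple_mod Z2 V1 n)" "multiply_out n z = \<zero>\<^bsub>bool_fun {1..n}\<^esub>"
      using NK by blast+
    then show "z \<in> N'"
      using z unfolding N'_def
      by (simp only: mem_Collect_eq lin_maps_zero[OF delta_section_lin B.module_axioms F.module_axioms]
          F.M.r_zero simp_thms)
  qed
  note gen = free_gen_closed[OF cring_Z2, of _ "tuples V1 n"]
  note subN' = F.submoduleE[OF N'_sub]
  have cV: "bit_delta b \<in> carrier V1" for b by simp
  have upd: "t(i := u) \<in> tuples V1 n" if "t \<in> tuples V1 n" "i \<in> {1..n}" "u \<in> carrier V1" for t i u
    using that by (auto simp: PiE_def extensional_def simp del: bool_fun_simps)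
  \<comment> \<open>By induction on \<open>k\<close>: only the first \<open>k\<close> slots may hold functions other than indicators.\<close>
  have gens: "free_gen Z2 t \<in> N'"
    if "t \<in> tuples V1 n" "k \<le> n" "\<forall>i\<in>{1..n}. k < i \<longrightarrow> t i \<in> range bit_delta" for k t
    using that
  proof (induction k arbitrary: t)
    case 0
    define g where "g = (\<lambda>i\<in>{1..n}. inv_into UNIV bit_delta (t i))"
    have "t = delta_tuple n g"
    proof (rule PiE_ext[OF 0(1) delta_tuple_closed])
      fix i assume i: "i \<in> {1..n}"
      then have "t i \<in> range bit_delta" using 0(3) by auto
      then show "t i = delta_tuple n g i"
        using i by (simp add: delta_tuple_def g_def f_inv_into_f)
    qed
    moreover have "g \<in> cube {1..n}" by (simp add: g_def)
    ultimately have "delta_section n (multiply_out n (free_gen Z2 t)) = free_gen Z2 t"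
      using 0(1) by (simp only: multiply_out_free_gen pure_fun_delta_tuple delta_section_point_fun)
    then have "free_gen Z2 t \<oplus>\<^bsub>tuple_mod Z2 V1 n\<^esub> delta_section n (multiply_out n (free_gen Z2 t)) \<in> ?N"
      by (simp only: self submodule_zero[OF N(1)])
    then show ?case using gen[OF 0(1)] by (simp only: N'_def mem_Collect_eq simp_thms)
  next
    case (Suc k)
    let ?i = "Suc k"
    have i: "?i \<in> {1..n}" using Suc.prems by auto
    have IH: "free_gen Z2 (t(?i := bit_delta b)) \<in> N'" for b
      using Suc.prems(2,3) by (intro Suc.IH upd[OF Suc.prems(1) i cV]) auto
    have "t ?i \<in> carrier V1" using Suc.prems(1) i by (rule PiE_mem)
    then consider (delta) b where "t ?i = bit_delta b" | (zero) "t ?i = 0 \<odot>\<^bsub>V1\<^esub> bit_delta 0"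
      | (sum) "t ?i = bit_delta 0 \<oplus>\<^bsub>V1\<^esub> bit_delta 1"
      using V1_cases[of "t ?i"] unfolding bool_fun_simps(1) by blast
    then show ?case
    proof cases
      case (delta b)
      with IH[of b] show ?thesis by (metis fun_upd_triv)
    next
      case zero
      let ?r = "free_gen Z2 (t(?i := 0 \<odot>\<^bsub>V1\<^esub> bit_delta 0)) \<ominus>\<^bsub>tuple_mod Z2 V1 n\<^esub>
        (0 \<odot>\<^bsub>tuple_mod Z2 V1 n\<^esub> free_gen Z2 (t(?i := bit_delta 0)))"
      have "?r \<in> multilinear_rels Z2 V1 n"
        by (rule multilinear_rels_smult[OF Suc.prems(1) i _ cV]) simp
      then have "?r \<in> N'" using N(2) N_N' by blast
      moreover have "?r \<oplus>\<^bsub>tuple_mod Z2 V1 n\<^esub> 0 \<odot>\<^bsub>tuple_mod Z2 V1 n\<^esub> free_gen Z2 (t(?i := bit_delta 0)) \<in> N'"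
        using calculation IH by (intro subN'(5) subN'(4)) auto
      moreover have "free_gen Z2 t = ?r \<oplus>\<^bsub>tuple_mod Z2 V1 n\<^esub> 0 \<odot>\<^bsub>tuple_mod Z2 V1 n\<^esub> free_gen Z2 (t(?i := bit_delta 0))"
      proof -
        have "0 \<odot>\<^bsub>tuple_mod Z2 V1 n\<^esub> free_gen Z2 (t(?i := bit_delta 0)) \<in> carrier (tuple_mod Z2 V1 n)"
          using IH subN'(1) by (intro F.smult_closed) auto
        then show ?thesis
          unfolding zero[symmetric] fun_upd_triv
          using gen[OF Suc.prems(1)]
          by (simp only: F.M.minus_eq F.M.a_assoc F.M.l_neg F.M.a_inv_closed F.M.r_zero)
      qed
      ultimately show ?thesis by simp
    next
      case sum
      let ?s = "free_gen Z2 (t(?i := bit_delta 0)) \<oplus>\<^bsub>tuple_mod Z2 V1 n\<^esub> free_gen Z2 (t(?i := bit_delta 1))"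
      let ?r = "free_gen Z2 (t(?i := bit_delta 0 \<oplus>\<^bsub>V1\<^esub> bit_delta 1)) \<ominus>\<^bsub>tuple_mod Z2 V1 n\<^esub> ?s"
      have "?r \<in> multilinear_rels Z2 V1 n"
        by (rule multilinear_rels_add[OF Suc.prems(1) i cV cV])
      then have r: "?r \<in> N'" using N(2) N_N' by blast
      have s: "?s \<in> N'" using IH by (intro subN'(5))
      have "free_gen Z2 t = ?r \<oplus>\<^bsub>tuple_mod Z2 V1 n\<^esub> ?s"
        unfolding sum[symmetric] fun_upd_triv
        using gen[OF Suc.prems(1)] subsetD[OF subN'(1) s]
        by (simp only: F.M.minus_eq F.M.a_assoc F.M.l_neg F.M.a_inv_closed F.M.r_zero)
      then show ?thesis using subN'(5)[OF r s] by simp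
    qed
  qed
  show "?Ker \<subseteq> ?N"
  proof
    fix z assume z: "z \<in> ?Ker"
    have "z \<in> N'"
    proof (rule free_mod_generated[OF cring_Z2 N'_sub])
      show "free_gen Z2 t \<in> N'" if "t \<in> tuples V1 n" for t
        by (rule gens[OF that order_refl]) auto
    qed (use z in blast)
    then have "z \<oplus>\<^bsub>tuple_mod Z2 V1 n\<^esub> delta_section n (multiply_out n z) \<in> ?N"
      by (simp only: N'_def mem_Collect_eq)
    then show "z \<in> ?N"
      using z by (simp only: mem_Collect_eq F.M.r_zero
          lin_maps_zero[OF delta_section_lin B.module_axioms F.module_axioms])
  qed
qed

abbreviation (input) V1_tensor :: "nat \<Rightarrow> (bit, ((nat \<Rightarrow> (nat \<Rightarrow> bit) \<Rightarrow> bit) \<Rightarrow> bit) set) module" where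
  "V1_tensor n \<equiv> tensor_pow Z2 V1 n"

lemma module_V1_tensor: "module Z2 (V1_tensor n)"
  and tensor_pow_iso: "\<exists>\<Phi>\<in>lin_maps Z2 (bool_fun {1..n}) (V1_tensor n).
    bij_betw \<Phi> (carrier (bool_fun {1..n})) (carrier (V1_tensor n)) \<and>
    (\<forall>t\<in>tuples V1 n. \<Phi> (pure_fun n t) = pure_tensor Z2 V1 n t)"
proof -
  have F: "module Z2 (tuple_mod Z2 V1 n)" by (rule module_free_mod[OF cring_Z2])
  have B: "module Z2 (bool_fun {1..n})" by (rule module_bool_fun)
  have surj: "multiply_out n ` carrier (tuple_mod Z2 V1 n) = carrier (bool_fun {1..n})"
  proof (intro equalityI subsetI)
    fix f assume f: "f \<in> carrier (bool_fun {1..n})"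
    show "f \<in> multiply_out n ` carrier (tuple_mod Z2 V1 n)"
      using multiply_out_delta_section[OF f, symmetric] lin_mapsD(1)[OF delta_section_lin f] by (rule image_eqI)
  next
    fix f assume "f \<in> multiply_out n ` carrier (tuple_mod Z2 V1 n)"
    then show "f \<in> carrier (bool_fun {1..n})" using lin_mapsD(1)[OF multiply_out_lin] by blast
  qed
  define \<Psi> where "\<Psi> = (\<lambda>C\<in>carrier (V1_tensor n). the_elem (multiply_out n ` C))"
  note iso = first_isomorphism[OF F B multiply_out_lin surj multilinear_submod_eq_kernel,
      folded tensor_pow_def, folded \<Psi>_def]
  show T: "module Z2 (V1_tensor n)" by (rule iso(1))
  define \<Phi> where "\<Phi> = restrict (inv_into (carrier (V1_tensor n)) \<Psi>) (carrier (bool_fun {1..n}))"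
  have "\<Phi> \<in> lin_maps Z2 (bool_fun {1..n}) (V1_tensor n)"
    unfolding \<Phi>_def by (rule inv_into_lin_maps[OF T iso(2,3)])
  moreover have "bij_betw \<Phi> (carrier (bool_fun {1..n})) (carrier (V1_tensor n))"
    using bij_betw_inv_into[OF iso(3)] by (simp only: \<Phi>_def bij_betw_restrict_eq)
  moreover have "\<Phi> (pure_fun n t) = pure_tensor Z2 V1 n t" if t: "t \<in> tuples V1 n" for t
  proof -
    have g: "free_gen Z2 t \<in> carrier (tuple_mod Z2 V1 n)" by (rule free_gen_closed[OF cring_Z2 t])
    have "\<Psi> (pure_tensor Z2 V1 n t) = pure_fun n t"
      unfolding pure_tensor_def by (simp only: iso(5)[OF g] multiply_out_free_gen[OF t])
    moreover have "pure_tensor Z2 V1 n t \<in> carrier (V1_tensor n)"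
      unfolding pure_tensor_def by (rule iso(4)[OF g])
    ultimately show ?thesis
      using bij_betw_inv_into_left[OF iso(3)] by (simp add: \<Phi>_def) metis
  qed
  ultimately show "\<exists>\<Phi>\<in>lin_maps Z2 (bool_fun {1..n}) (V1_tensor n).
    bij_betw \<Phi> (carrier (bool_fun {1..n})) (carrier (V1_tensor n)) \<and>
    (\<forall>t\<in>tuples V1 n. \<Phi> (pure_fun n t) = pure_tensor Z2 V1 n t)" by blast
qed

section \<open>Permuting the variables\<close>

text \<open>The action of \<open>\<alpha>\<close> on tuples of vectors, and likewise on points of the cube.\<close>
definition reindex :: "nat \<Rightarrow> (nat \<Rightarrow> nat) \<Rightarrow> (nat \<Rightarrow> 'v) \<Rightarrow> nat \<Rightarrow> 'v" where
  "reindex n \<alpha> g = (\<lambda>i\<in>{1..n}. g (\<alpha> i))"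

text \<open>The inverse appears because a function is composed with a map of the cube: this is what
  \<open>v\<^sub>1 \<otimes> \<dots> \<otimes> v\<^sub>n \<mapsto> v\<^bsub>\<alpha> 1\<^esub> \<otimes> \<dots> \<otimes> v\<^bsub>\<alpha> n\<^esub>\<close> becomes on functions of \<open>n\<close> bits.\<close>
definition perm_fun :: "nat \<Rightarrow> (nat \<Rightarrow> nat) \<Rightarrow> ((nat \<Rightarrow> bit) \<Rightarrow> bit) \<Rightarrow> (nat \<Rightarrow> bit) \<Rightarrow> bit" where
  "perm_fun n \<alpha> = (\<lambda>f\<in>carrier (bool_fun {1..n}). \<lambda>g\<in>cube {1..n}. f (reindex n (inv_into UNIV \<alpha>) g))"

lemma reindex_cube [simp]: "reindex n \<alpha> g \<in> cube {1..n}"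
  by (simp add: reindex_def)

lemma perm_fun_apply:
  "f \<in> extensional (cube {1..n}) \<Longrightarrow> g \<in> cube {1..n} \<Longrightarrow>
    perm_fun n \<alpha> f g = f (reindex n (inv_into UNIV \<alpha>) g)"
  by (simp add: perm_fun_def)

lemma perm_fun_closed [simp]:
  "f \<in> extensional (cube {1..n}) \<Longrightarrow> perm_fun n \<alpha> f \<in> extensional (cube {1..n})"
  by (simp add: perm_fun_def)

lemma perm_fun_lin: "perm_fun n \<alpha> \<in> lin_maps Z2 (bool_fun {1..n}) (bool_fun {1..n})"
proof (rule lin_mapsI)
  show "perm_fun n \<alpha> f = undefined" if "f \<notin> carrier (bool_fun {1..n})" for f
    using that by (simp add: perm_fun_def)
  fix f assume f: "f \<in> carrier (bool_fun {1..n})"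
  then show "perm_fun n \<alpha> f \<in> carrier (bool_fun {1..n})" by simp
  show "perm_fun n \<alpha> (c \<odot>\<^bsub>bool_fun {1..n}\<^esub> f) = c \<odot>\<^bsub>bool_fun {1..n}\<^esub> perm_fun n \<alpha> f" for c
    using f by (intro extensionalityI[where A = "cube {1..n}"]) (simp_all add: perm_fun_apply)
  fix h assume "h \<in> carrier (bool_fun {1..n})"
  then show "perm_fun n \<alpha> (f \<oplus>\<^bsub>bool_fun {1..n}\<^esub> h) = perm_fun n \<alpha> f \<oplus>\<^bsub>bool_fun {1..n}\<^esub> perm_fun n \<alpha> h"
    using f by (intro extensionalityI[where A = "cube {1..n}"]) (simp_all add: perm_fun_apply)
qed

lemma reindex_inv:
  assumes "\<alpha> permutes {1..n}" "g \<in> cube {1..n}"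
  shows "reindex n \<alpha> (reindex n (inv_into UNIV \<alpha>) g) = g"
proof (rule PiE_ext[OF reindex_cube assms(2)])
  fix i assume "i \<in> {1..n}"
  then show "reindex n \<alpha> (reindex n (inv_into UNIV \<alpha>) g) i = g i"
    using assms(1) by (simp add: reindex_def permutes_in_image permutes_inverses(2) del: atLeastAtMost_iff)
qed

text \<open>Reindex the product of the values by \<open>\<alpha>\<close>.\<close>
lemma perm_fun_pure_fun:
  assumes \<alpha>: "\<alpha> permutes {1..n}"
  shows "perm_fun n \<alpha> (pure_fun n t) = pure_fun n (reindex n \<alpha> t)"
proof (rule extensionalityI[where A = "cube {1..n}"])
  fix g assume g: "g \<in> cube {1..n}"
  have "perm_fun n \<alpha> (pure_fun n t) g = (\<Prod>i\<in>{1..n}. t i (bit_point (g (inv_into UNIV \<alpha> i))))"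
    using g by (simp add: perm_fun_apply pure_fun_def reindex_def)
  also have "\<dots> = (\<Prod>i\<in>{1..n}. t (\<alpha> i) (bit_point (g i)))"
    by (subst prod.permute[OF \<alpha>]) (simp add: permutes_inverses(2)[OF \<alpha>])
  also have "\<dots> = pure_fun n (reindex n \<alpha> t) g"
    using g by (simp add: pure_fun_def reindex_def)
  finally show "perm_fun n \<alpha> (pure_fun n t) g = pure_fun n (reindex n \<alpha> t) g" .
qed simp_all

lemma ops_map_opword:
  assumes "\<And>a. a \<in> x \<Longrightarrow> \<sigma> a \<in> y" "p \<in> ops x"
  shows "map_opword \<sigma> p \<in> ops y"
  using assms(2) by (induction rule: ops.induct) (auto intro: assms(1))

text \<open>Conjugation by the reindexing is multiplicative and additive, so the claim reduces to the
  letters. There it holds because reindexing a point moves its coordinate at \<open>\<alpha>\<^sup>-\<^sup>1(a)\<close> to \<open>a\<close>, and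
  hence the flip at \<open>\<alpha>\<^sup>-\<^sup>1(a)\<close> to the flip at \<open>a\<close>.\<close>
lemma val_map_opword:
  assumes \<alpha>: "\<alpha> permutes {1..n}" and p: "p \<in> ops {1..n}" and f: "f \<in> extensional (cube {1..n})"
  shows "val {1..n} (map_opword (inv_into UNIV \<alpha>) p) f =
    perm_fun n \<alpha> (val {1..n} p (perm_fun n (inv_into UNIV \<alpha>) f))"
  using p f
proof (induction arbitrary: f rule: ops.induct)
  define \<sigma> where "\<sigma> = inv_into UNIV \<alpha>"
  have inv\<sigma>: "inv_into UNIV \<sigma> = \<alpha>" unfolding \<sigma>_def by (rule permutes_inv_inv[OF \<alpha>])
  have \<sigma>: "\<sigma> permutes {1..n}" unfolding \<sigma>_def by (rule permutes_inv[OF \<alpha>])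
  have \<sigma>_in: "\<sigma> a \<in> {1..n}" if "a \<in> {1..n}" for a using permutes_in_image[OF \<sigma>] that by blast
  have re: "reindex n \<alpha> (reindex n \<sigma> g) = g" if "g \<in> cube {1..n}" for g :: "nat \<Rightarrow> bit"
    unfolding \<sigma>_def using \<alpha> that by (rule reindex_inv)
  have cancel: "perm_fun n \<alpha> (perm_fun n \<sigma> f) = f" if "f \<in> extensional (cube {1..n})" for f
    using that
    by (intro extensionalityI[where A = "cube {1..n}"])
      (simp_all add: perm_fun_apply inv\<sigma> re flip: \<sigma>_def)
  have cancel': "perm_fun n \<sigma> (perm_fun n \<alpha> f) = f" if "f \<in> extensional (cube {1..n})" for f
  proof (rule extensionalityI[where A = "cube {1..n}"])
    fix g assume "g \<in> cube {1..n}"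
    then show "perm_fun n \<sigma> (perm_fun n \<alpha> f) g = f g"
      using that reindex_inv[OF \<sigma>, of g] by (simp add: perm_fun_apply inv\<sigma> flip: \<sigma>_def)
  qed (use that in simp_all)
  note ext = extensionalityI[where A = "cube {1..n}"]
  have [simp]: "map_opword \<sigma> p \<in> ops {1..n}" if "p \<in> ops {1..n}" for p
    using \<sigma>_in that by (rule ops_map_opword)
  {
    case (1 a)
    show ?case
      unfolding \<sigma>_def[symmetric]
    proof (rule ext)
      fix g assume g: "g \<in> cube {1..n}"
      then show "val {1..n} (map_opword \<sigma> (Co a)) f g =
          perm_fun n \<alpha> (val {1..n} (Co a) (perm_fun n \<sigma> f)) g"
        using 1 by (simp add: perm_fun_apply inv\<sigma> re flip: \<sigma>_def) (simp add: reindex_def)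
    qed (use 1 \<sigma>_in in \<open>auto intro!: val_ext\<close>)
  next
    case (2 a)
    show ?case
      unfolding \<sigma>_def[symmetric]
    proof (rule ext)
      fix g assume g: "g \<in> cube {1..n}"
      have flip: "reindex n \<alpha> ((reindex n \<sigma> g)(a := g (\<sigma> a) + 1)) = g(\<sigma> a := g (\<sigma> a) + 1)"
      proof (rule PiE_ext[OF reindex_cube flip_cube[OF g \<sigma>_in[OF 2(1)]]])
        fix i assume i: "i \<in> {1..n}"
        then have "\<alpha> i \<in> {1..n}" using permutes_in_image[OF \<alpha>] by blast
        moreover have "\<alpha> i = a \<longleftrightarrow> i = \<sigma> a"
          unfolding \<sigma>_def using permutes_inverses[OF \<alpha>] by metis
        moreover have "\<sigma> (\<alpha> i) = i" unfolding \<sigma>_def by (rule permutes_inverses(2)[OF \<alpha>])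
        ultimately show "reindex n \<alpha> ((reindex n \<sigma> g)(a := g (\<sigma> a) + 1)) i = (g(\<sigma> a := g (\<sigma> a) + 1)) i"
          using i by (auto simp: reindex_def)
      qed
      have at: "reindex n \<sigma> g a = g (\<sigma> a)" using 2(1) by (simp only: reindex_def restrict_apply')
      have "perm_fun n \<alpha> (val {1..n} (Dv a) (perm_fun n \<sigma> f)) g =
          val {1..n} (Dv a) (perm_fun n \<sigma> f) (reindex n \<sigma> g)"
        using 2 g by (subst perm_fun_apply) (auto simp flip: \<sigma>_def)
      also have "\<dots> = perm_fun n \<sigma> f ((reindex n \<sigma> g)(a := g (\<sigma> a) + 1)) + perm_fun n \<sigma> f (reindex n \<sigma> g)"
        using 2 by (subst val_Dv) (simp_all only: at perm_fun_closed reindex_cube)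
      also have "\<dots> = f (g(\<sigma> a := g (\<sigma> a) + 1)) + f g"
        using 2 g by (simp only: perm_fun_apply reindex_cube flip_cube inv\<sigma> flip re)
      also have "\<dots> = val {1..n} (map_opword \<sigma> (Dv a)) f g"
        using 2(2) g \<sigma>_in[OF 2(1)] by (simp only: opword.map val_Dv)
      finally show "val {1..n} (map_opword \<sigma> (Dv a)) f g =
          perm_fun n \<alpha> (val {1..n} (Dv a) (perm_fun n \<sigma> f)) g" by (rule HOL.sym)
    qed (use 2 \<sigma>_in in \<open>auto intro!: val_ext\<close>)
  next
    case 3
    then show ?case
      unfolding \<sigma>_def[symmetric] by (intro ext) (simp_all add: perm_fun_apply)
  next
    case 4
    then show ?case
      unfolding \<sigma>_def[symmetric] by (simp add: cancel)
  next
    case (5 p q)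
    then show ?case
      unfolding \<sigma>_def[symmetric] by (simp add: cancel')
  next
    case (6 p q)
    then show ?case
      unfolding \<sigma>_def[symmetric] by (intro ext) (simp_all add: perm_fun_apply)
  }
qed

lemma OR_act_bw_class:
  assumes \<alpha>: "\<alpha> permutes {1..n}" and p: "p \<in> ops {1..n}"
  shows "OR_act n (bw_class {1..n} p) \<alpha> = bw_class {1..n} (map_opword (inv_into UNIV \<alpha>) p)"
proof -
  let ?\<sigma> = "inv_into UNIV \<alpha>"
  have \<sigma>: "?\<sigma> a \<in> {1..n}" if "a \<in> {1..n}" for a
    using permutes_in_image[OF permutes_inv[OF \<alpha>]] that by blast
  have "bw_rel {1..n} `` {map_opword ?\<sigma> q} = bw_class {1..n} (map_opword ?\<sigma> p)"
    if "q \<in> bw_class {1..n} p" for q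
  proof -
    have pq: "(p, q) \<in> bw_rel {1..n}" using that by (simp add: bw_class_def)
    then have q: "q \<in> ops {1..n}" by (blast dest: bw_rel_ops)
    have "val {1..n} (map_opword ?\<sigma> q) = val {1..n} (map_opword ?\<sigma> p)"
      using p q by (intro val_eqI ops_map_opword[OF \<sigma>])
        (simp_all only: val_map_opword[OF \<alpha>] bw_rel_sound[OF pq])
    then have "(map_opword ?\<sigma> q, map_opword ?\<sigma> p) \<in> bw_rel {1..n}"
      using p q by (intro bw_rel_complete ops_map_opword[OF \<sigma>]) auto
    then show ?thesis by (simp only: bw_class_eqI flip: bw_class_def)
  qed
  moreover have "p \<in> bw_class {1..n} p" using p by (simp add: bw_class_def bw_rel.refl)
  ultimately show ?thesis
    unfolding OR_act_def OR_map_def op_rel_eq_bw_rel[OF finite_atLeastAtMost] by blast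
qed

text \<open>Identifies the operator given by a definite description: the conjugate has the required values
  on pure tensors, and it is the only such linear map because the pure tensors of indicators
  correspond to the basis of indicators of points.\<close>
lemma perm_op_eq_conj:
  assumes \<alpha>: "\<alpha> permutes {1..n}"
    and \<Phi>: "\<Phi> \<in> lin_maps Z2 (bool_fun {1..n}) (V1_tensor n)"
    and bij: "bij_betw \<Phi> (carrier (bool_fun {1..n})) (carrier (V1_tensor n))"
    and pure: "\<And>t. t \<in> tuples V1 n \<Longrightarrow> \<Phi> (pure_fun n t) = pure_tensor Z2 V1 n t"
  shows "perm_op Z2 V1 n \<alpha> = conj_map (bool_fun {1..n}) (V1_tensor n) \<Phi> (perm_fun n \<alpha>)"
  unfolding perm_op_def
proof (rule the_equality)
  let ?B = "bool_fun {1..n}" and ?T = "V1_tensor n"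
  let ?h = "conj_map ?B ?T \<Phi> (perm_fun n \<alpha>)"
  have pc: "pure_fun n t \<in> carrier ?B" for t by simp
  have iso: "alg_iso Z2 (End_alg Z2 ?B) (End_alg Z2 ?T) (conj_map ?B ?T \<Phi>)"
    by (rule conj_map_alg_iso[OF module_bool_fun module_V1_tensor \<Phi> bij])
  have h: "?h \<in> lin_maps Z2 ?T ?T"
    using ring_iso_memE(1)[of "conj_map ?B ?T \<Phi>" "End_alg Z2 ?B" "End_alg Z2 ?T" "perm_fun n \<alpha>"]
      iso perm_fun_lin[of n \<alpha>]
    unfolding alg_iso_def End_alg_simps by blast
  have h_pure: "?h (pure_tensor Z2 V1 n t) = pure_tensor Z2 V1 n (\<lambda>i\<in>{1..n}. t (\<alpha> i))"
    if t: "t \<in> tuples V1 n" for t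
  proof -
    have T: "pure_tensor Z2 V1 n t \<in> carrier ?T"
      unfolding pure[OF t, symmetric] by (rule lin_mapsD(1)[OF \<Phi> pc])
    have t': "reindex n \<alpha> t \<in> tuples V1 n"
      unfolding reindex_def using t permutes_in_image[OF \<alpha>] by (intro restrict_PiE_iff[THEN iffD2] ballI PiE_mem[OF t]) blast
    have "?h (pure_tensor Z2 V1 n t) = \<Phi> (perm_fun n \<alpha> (inv_into (carrier ?B) \<Phi> (\<Phi> (pure_fun n t))))"
      using T by (simp only: conj_map_def restrict_apply' pure[OF t])
    also have "\<dots> = \<Phi> (pure_fun n (reindex n \<alpha> t))"
      by (simp only: bij_betw_inv_into_left[OF bij pc] perm_fun_pure_fun[OF \<alpha>])
    finally show ?thesis by (simp only: pure[OF t', unfolded reindex_def] reindex_def)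
  qed
  show "?h \<in> End_prop Z2 V1 n n \<and>
      (\<forall>t\<in>tuples V1 n. ?h (pure_tensor Z2 V1 n t) = pure_tensor Z2 V1 n (\<lambda>i\<in>{1..n}. t (\<alpha> i)))"
    unfolding End_prop_def using h h_pure by blast
  fix k assume k: "k \<in> End_prop Z2 V1 n n \<and>
      (\<forall>t\<in>tuples V1 n. k (pure_tensor Z2 V1 n t) = pure_tensor Z2 V1 n (\<lambda>i\<in>{1..n}. t (\<alpha> i)))"
  then have k_lin: "k \<in> lin_maps Z2 ?T ?T" by (simp add: End_prop_def)
  have eq: "compose (carrier ?B) k \<Phi> = compose (carrier ?B) ?h \<Phi>"
  proof (rule bool_fun_lin_maps_eqI[OF _ module_V1_tensor])
    show "compose (carrier ?B) k \<Phi> \<in> lin_maps Z2 ?B ?T" "compose (carrier ?B) ?h \<Phi> \<in> lin_maps Z2 ?B ?T"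
      by (rule lin_maps_compose[OF \<Phi> _ module_bool_fun]; fact)+
    fix g assume g: "g \<in> cube {1..n}"
    have "k (\<Phi> (pure_fun n (delta_tuple n g))) = ?h (\<Phi> (pure_fun n (delta_tuple n g)))"
      using k h_pure delta_tuple_closed[of n g] by (simp only: pure)
    then show "compose (carrier ?B) k \<Phi> (point_fun {1..n} g) = compose (carrier ?B) ?h \<Phi> (point_fun {1..n} g)"
      using pc[of "delta_tuple n g"] by (simp only: pure_fun_delta_tuple[OF g] compose_def restrict_apply')
  qed simp
  show "k = ?h"
  proof (rule lin_maps_eqI[OF k_lin h])
    fix y assume "y \<in> carrier ?T"
    then obtain f where f: "f \<in> carrier ?B" "y = \<Phi> f" using bij by (metis bij_betw_imp_surj_on imageE)
    from fun_cong[OF eq, of f] f show "k y = ?h y" by (simp only: compose_def restrict_apply')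
  qed
qed

definition class_to_End :: "nat \<Rightarrow> (((nat \<Rightarrow> bit) \<Rightarrow> bit) \<Rightarrow> ((nat \<Rightarrow> (nat \<Rightarrow> bit) \<Rightarrow> bit) \<Rightarrow> bit) set)
    \<Rightarrow> nat opword set \<Rightarrow> ((nat \<Rightarrow> (nat \<Rightarrow> bit) \<Rightarrow> bit) \<Rightarrow> bit) set \<Rightarrow> ((nat \<Rightarrow> (nat \<Rightarrow> bit) \<Rightarrow> bit) \<Rightarrow> bit) set" where
  "class_to_End n \<Phi> = conj_map (bool_fun {1..n}) (V1_tensor n) \<Phi> \<circ> class_val {1..n}"

lemma class_to_End_iso:
  assumes \<Phi>: "\<Phi> \<in> lin_maps Z2 (bool_fun {1..n}) (V1_tensor n)"
    and bij: "bij_betw \<Phi> (carrier (bool_fun {1..n})) (carrier (V1_tensor n))"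
  shows "alg_iso Z2 (OR {1..n}) (End_diag Z2 V1 n) (class_to_End n \<Phi>)"
proof -
  have "alg_iso Z2 (OR {1..n}) (End_alg Z2 (V1_tensor n))
      (conj_map (bool_fun {1..n}) (V1_tensor n) \<Phi> \<circ> class_val {1..n})"
    by (rule alg_iso_trans[OF OR_iso_End_bool_fun[OF finite_atLeastAtMost]
          conj_map_alg_iso[OF module_bool_fun module_V1_tensor \<Phi> bij]])
  then show ?thesis by (simp only: End_diag_def class_to_End_def)
qed

text \<open>Both actions of \<open>\<alpha>\<close> are conjugation by its reindexing, on the functions of \<open>n\<close> bits and on the
  tensor power, and \<^const>\<open>conj_map\<close> is multiplicative.\<close>
lemma class_to_End_equivariant:
  assumes \<alpha>: "\<alpha> permutes {1..n}" and P: "P \<in> carrier (OR {1..n})"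
    and \<Phi>: "\<Phi> \<in> lin_maps Z2 (bool_fun {1..n}) (V1_tensor n)"
    and bij: "bij_betw \<Phi> (carrier (bool_fun {1..n})) (carrier (V1_tensor n))"
    and pure: "\<And>t. t \<in> tuples V1 n \<Longrightarrow> \<Phi> (pure_fun n t) = pure_tensor Z2 V1 n t"
  shows "class_to_End n \<Phi> (OR_act n P \<alpha>) = End_act Z2 V1 n (class_to_End n \<Phi> P) \<alpha>"
proof -
  let ?\<sigma> = "inv_into UNIV \<alpha>" and ?B = "bool_fun {1..n}" and ?T = "V1_tensor n"
  let ?C = "conj_map ?B ?T \<Phi>"
  have \<sigma>: "?\<sigma> permutes {1..n}" by (rule permutes_inv[OF \<alpha>])
  have iso: "?C \<in> ring_iso (End_alg Z2 ?B) (End_alg Z2 ?T)"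
    using conj_map_alg_iso[OF module_bool_fun module_V1_tensor \<Phi> bij] by (simp only: alg_iso_def)
  note hom = ring_iso_memE(2)[OF iso, unfolded End_alg_simps(1)]
  obtain p where p: "P = bw_class {1..n} p" "p \<in> ops {1..n}"
    using P by (auto simp: OR_eq_bw_quot carrier_bw_quot)
  have in_ops: "map_opword ?\<sigma> p \<in> ops {1..n}"
    by (rule ops_map_opword[OF _ p(2)]) (simp only: permutes_in_image[OF \<sigma>])
  note v = val_closed[OF p(2)]
  note pf = perm_fun_lin[of n \<alpha>] perm_fun_lin[of n ?\<sigma>]
  have m: "perm_fun n \<alpha> \<otimes>\<^bsub>End_alg Z2 ?B\<^esub> val {1..n} p \<in> lin_maps Z2 ?B ?B"
    unfolding End_alg_simps by (rule End_alg_closed(1)[OF module_bool_fun pf(1) v])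
  have "val {1..n} (map_opword ?\<sigma> p) =
      perm_fun n \<alpha> \<otimes>\<^bsub>End_alg Z2 ?B\<^esub> val {1..n} p \<otimes>\<^bsub>End_alg Z2 ?B\<^esub> perm_fun n ?\<sigma>"
  proof (rule lin_maps_eqI[OF val_closed[OF in_ops]])
    show "perm_fun n \<alpha> \<otimes>\<^bsub>End_alg Z2 ?B\<^esub> val {1..n} p \<otimes>\<^bsub>End_alg Z2 ?B\<^esub> perm_fun n ?\<sigma> \<in> lin_maps Z2 ?B ?B"
      using m unfolding End_alg_simps by (rule End_alg_closed(1)[OF module_bool_fun _ pf(2)])
    fix f assume "f \<in> carrier ?B"
    then show "val {1..n} (map_opword ?\<sigma> p) f =
        (perm_fun n \<alpha> \<otimes>\<^bsub>End_alg Z2 ?B\<^esub> val {1..n} p \<otimes>\<^bsub>End_alg Z2 ?B\<^esub> perm_fun n ?\<sigma>) f"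
      by (simp add: val_map_opword[OF \<alpha> p(2)] compose_def)
  qed
  then have "?C (val {1..n} (map_opword ?\<sigma> p)) =
      ?C (perm_fun n \<alpha>) \<otimes>\<^bsub>End_alg Z2 ?T\<^esub> ?C (val {1..n} p) \<otimes>\<^bsub>End_alg Z2 ?T\<^esub> ?C (perm_fun n ?\<sigma>)"
    by (simp only: hom[OF m pf(2)] hom[OF pf(1) v])
  then show ?thesis
    unfolding class_to_End_def End_act_def End_diag_def
    by (simp only: comp_apply p(1) OR_act_bw_class[OF \<alpha> p(2)] class_val_bw_class[OF in_ops]
        class_val_bw_class[OF p(2)] perm_op_eq_conj[OF \<alpha> \<Phi> bij pure] perm_op_eq_conj[OF \<sigma> \<Phi> bij pure])
qed

lemma is_boole_weyl_OR: "is_boole_weyl n (OR {1..n})"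
proof -
  have "k_algebra Z2 (OR {1..n})"
    by (rule k_algebra_if_alg_iso[OF OR_iso_End_bool_fun[OF finite_atLeastAtMost]])
  then have "alg_iso Z2 (boole_weyl n) (OR {1..n}) (\<lambda>P. P)"
    unfolding boole_weyl_def OR_eq_bw_quot[OF finite_atLeastAtMost] by (rule alg_iso_refl)
  then show ?thesis unfolding is_boole_weyl_def by blast
qed

theorem theorem41:
  shows "(\<forall>n. is_boole_weyl n (OR {1..n}) \<and> is_boole_weyl n (End_diag Z2 (bool_fun {1::nat}) n)) \<and>
    (\<exists>\<phi>. \<forall>n. alg_iso Z2 (OR {1..n}) (End_diag Z2 (bool_fun {1::nat}) n) (\<phi> n) \<and>
      (\<forall>\<alpha> P. \<alpha> permutes {1..n} \<and> P \<in> carrier (OR {1..n}) \<longrightarrow>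
         \<phi> n (OR_act n P \<alpha>) = End_act Z2 (bool_fun {1::nat}) n (\<phi> n P) \<alpha>))"
proof -
  obtain \<Phi> where \<Phi>: "\<And>n. \<Phi> n \<in> lin_maps Z2 (bool_fun {1..n}) (V1_tensor n)"
    "\<And>n. bij_betw (\<Phi> n) (carrier (bool_fun {1..n})) (carrier (V1_tensor n))"
    "\<And>n t. t \<in> tuples V1 n \<Longrightarrow> \<Phi> n (pure_fun n t) = pure_tensor Z2 V1 n t"
    using tensor_pow_iso by metis
  have iso: "alg_iso Z2 (OR {1..n}) (End_diag Z2 V1 n) (class_to_End n (\<Phi> n))" for n
    by (rule class_to_End_iso[OF \<Phi>(1,2)])
  have "is_boole_weyl n (End_diag Z2 V1 n)" for n
    using is_boole_weyl_OR[of n] alg_iso_trans[OF _ iso[of n]] unfolding is_boole_weyl_def by blast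
  moreover have "class_to_End n (\<Phi> n) (OR_act n P \<alpha>) = End_act Z2 V1 n (class_to_End n (\<Phi> n) P) \<alpha>"
    if "\<alpha> permutes {1..n}" "P \<in> carrier (OR {1..n})" for n \<alpha> P
    using that \<Phi> by (intro class_to_End_equivariant)
  ultimately show ?thesis
    using is_boole_weyl_OR iso by (intro conjI allI exI[of _ "\<lambda>n. class_to_End n (\<Phi> n)"]) blast+
qed

end
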